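(* Let $\Phi$ be a classical irreducible root system (type $\mathrm A$, $\mathrm B$, $\mathrm C$ or $\mathrm D$) with simple system $\Pi$, let $\Phi^+_t$ be the set of all positive roots of length $t$ in $\Phi$, where $t$ is the length of some root, and let $\{\varepsilon_1,\dots,\varepsilon_r\}$ be the set of all simple roots of length $t$, ordered in such a way that the root subsystem generated by $\Pi\setminus\{\varepsilon_1,\dots,\varepsilon_i\}$ is irreducible for each $i\in\{1,\dots,r\}$. Then $$|\Phi^+_t|=\sum_{i=1}^r\frac{|W^{(i)}_{\varepsilon_i}|}{|W^{(i)}_{\varepsilon_i,\varepsilon_i'}|}.$$
   Context: $\Phi$ is finite, reduced and crystallographic. For $T\subseteq\Phi$, $W\langle T\rangle$ is the subgroup of the Weyl group generated by the reflections $s_\beta$, $\beta\in T$. For $i\in\{1,\dots,r\}$ let $\Pi^{(i)}=\Pi\setminus\{\varepsilon_j:j<i\}$. By the choice of ordering, $\varepsilon_i$ is a leaf of the Dynkin diagram of $\Pi^{(i)}$; $\varepsilon_i'$ denotes its unique neighbour in that diagram, i.e. $\{\varepsilon\in\Pi^{(i)}:(\varepsilon,\varepsilon_i)\neq0\}=\{\varepsilon_i,\varepsilon_i'\}$. Set $W^{(i)}_{\varepsilon_i}=W\langle\Pi^{(i)}\setminus\{\varepsilon_i\}\rangle$ and $W^{(i)}_{\varepsilon_i,\varepsilon_i'}=W\langle\Pi^{(i)}\setminus\{\varepsilon_i,\varepsilon_i'\}\rangle$. Conventions for the simply laced case with $i=r$: the empty root system counts as irreducible, and when $\Pi^{(r)}=\{\varepsilon_r\}$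 there is no $\varepsilon_r'$ and both groups are trivial, so the corresponding summand is $1$. *)

theory Defs
  imports "HOL-Analysis.Analysis" "HOL-Algebra.Bij" "HOL-Algebra.Generated_Groups"
begin

definition cartan_number :: "'a::euclidean_space \<Rightarrow> 'a \<Rightarrow> real" where
  "cartan_number \<beta> \<alpha> = 2 * (\<beta> \<bullet> \<alpha>) / (\<alpha> \<bullet> \<alpha>)"

definition reflection :: "'a::euclidean_space \<Rightarrow> 'a \<Rightarrow> 'a" where
  "reflection \<alpha> x = x - cartan_number x \<alpha> *\<^sub>R \<alpha>"

text \<open>Finite reduced crystallographic root systems.  The roots need not span the ambient space,
  and the empty set is a root system.\<close>

definition root_system :: "'a::euclidean_space set \<Rightarrow> bool" where
  "root_system \<Phi> \<longleftrightarrow>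
     finite \<Phi> \<and> 0 \<notin> \<Phi> \<and>
     (\<forall>\<alpha>\<in>\<Phi>. \<forall>\<beta>\<in>\<Phi>. reflection \<alpha> \<beta> \<in> \<Phi>) \<and>
     (\<forall>\<alpha>\<in>\<Phi>. \<forall>c::real. c *\<^sub>R \<alpha> \<in> \<Phi> \<longrightarrow> c = 1 \<or> c = - 1) \<and>
     (\<forall>\<alpha>\<in>\<Phi>. \<forall>\<beta>\<in>\<Phi>. cartan_number \<beta> \<alpha> \<in> \<int>)"

text \<open>With this definition the empty root system is irreducible.\<close>

definition irreducible_rs :: "'a::euclidean_space set \<Rightarrow> bool" where
  "irreducible_rs \<Phi> \<longleftrightarrow>
     \<not> (\<exists>A B. A \<noteq> {} \<and> B \<noteq> {} \<and> A \<inter> B = {} \<and> A \<union> B = \<Phi> \<and> (\<forall>\<alpha>\<in>A. \<forall>\<beta>\<in>B. \<alpha> \<bullet> \<beta> = 0))"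

definition simple_system :: "'a::euclidean_space set \<Rightarrow> 'a set \<Rightarrow> bool" where
  "simple_system \<Phi> \<Delta> \<longleftrightarrow>
     \<Delta> \<subseteq> \<Phi> \<and> independent \<Delta> \<and>
     (\<forall>\<alpha>\<in>\<Phi>. \<exists>c. \<alpha> = (\<Sum>\<beta>\<in>\<Delta>. c \<beta> *\<^sub>R \<beta>) \<and> ((\<forall>\<beta>\<in>\<Delta>. 0 \<le> c \<beta>) \<or> (\<forall>\<beta>\<in>\<Delta>. c \<beta> \<le> 0)))"

definition positive_roots :: "'a::euclidean_space set \<Rightarrow> 'a set \<Rightarrow> 'a set" where
  "positive_roots \<Phi> \<Delta> = {\<alpha>\<in>\<Phi>. \<exists>c. \<alpha> = (\<Sum>\<beta>\<in>\<Delta>. c \<beta> *\<^sub>R \<beta>) \<and> (\<forall>\<beta>\<in>\<Delta>. 0 \<le> c \<beta>)}"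

text \<open>The smallest root subsystem of \<open>\<Phi>\<close> containing \<open>T\<close>.\<close>

definition generated_subsystem :: "'a::euclidean_space set \<Rightarrow> 'a set \<Rightarrow> 'a set" where
  "generated_subsystem \<Phi> T = (\<lambda>\<Psi>. root_system \<Psi> \<and> \<Psi> \<subseteq> \<Phi>) hull T"

definition reflection_group :: "'a::euclidean_space set \<Rightarrow> ('a \<Rightarrow> 'a) set" where
  "reflection_group T = generate (BijGroup UNIV) (reflection ` T)"

text \<open>Cartan matrices of the classical types with rows and columns indexed by \<open>1, \<dots>, n\<close>, in the
  convention that the \<open>(i, j)\<close> entry is \<open>2 (\<alpha>\<^sub>i, \<alpha>\<^sub>j) / (\<alpha>\<^sub>j, \<alpha>\<^sub>j)\<close>.  Thus
  \<open>\<alpha>\<^sub>n\<close> is the short simple root in type B and the long one in type C, and in type D the nodes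
  \<open>n - 1\<close> and \<open>n\<close> are both attached to the node \<open>n - 2\<close>.\<close>

datatype classical_type = type_A | type_B | type_C | type_D

definition path_matrix :: "nat \<Rightarrow> nat \<Rightarrow> int" where
  "path_matrix i j = (if i = j then 2 else if i = j + 1 \<or> j = i + 1 then - 1 else 0)"

fun cartan_matrix :: "classical_type \<Rightarrow> nat \<Rightarrow> nat \<Rightarrow> nat \<Rightarrow> int" where
  "cartan_matrix type_A n i j = path_matrix i j"
| "cartan_matrix type_B n i j = (if i = n - 1 \<and> j = n then - 2 else path_matrix i j)"
| "cartan_matrix type_C n i j = (if i = n \<and> j = n - 1 then - 2 else path_matrix i j)"
| "cartan_matrix type_D n i j =
     (if {i, j} = {n - 1, n} then 0
      else if {i, j} = {n - 2, n} then - 1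
      else path_matrix i j)"

fun min_rank :: "classical_type \<Rightarrow> nat" where
  "min_rank type_A = 1"
| "min_rank type_B = 2"
| "min_rank type_C = 3"
| "min_rank type_D = 4"

definition has_type :: "'a::euclidean_space set \<Rightarrow> classical_type \<Rightarrow> nat \<Rightarrow> bool" where
  "has_type \<Phi> X n \<longleftrightarrow>
     (\<exists>\<Delta> a. simple_system \<Phi> \<Delta> \<and> bij_betw a {1..n} \<Delta> \<and>
        (\<forall>i\<in>{1..n}. \<forall>j\<in>{1..n}. cartan_number (a i) (a j) = of_int (cartan_matrix X n i j)))"

definition classical :: "'a::euclidean_space set \<Rightarrow> bool" where
  "classical \<Phi> \<longleftrightarrow> (\<exists>X n. min_rank X \<le> n \<and> has_type \<Phi> X n)"

text \<open>The unique neighbour of the leaf \<open>\<alpha>\<close> in the Dynkin diagram with vertex set \<open>S\<close>.\<close>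

definition leaf_neighbour :: "'a::euclidean_space set \<Rightarrow> 'a \<Rightarrow> 'a" where
  "leaf_neighbour S \<alpha> = (THE \<beta>. \<beta> \<noteq> \<alpha> \<and> {\<gamma>\<in>S. \<gamma> \<bullet> \<alpha> \<noteq> 0} = {\<alpha>, \<beta>})"

definition remaining_simple :: "'a set \<Rightarrow> (nat \<Rightarrow> 'a) \<Rightarrow> nat \<Rightarrow> 'a set" where
  "remaining_simple \<Delta> \<epsilon> i = \<Delta> - \<epsilon> ` {1..<i}"

definition W_leaf :: "'a::euclidean_space set \<Rightarrow> (nat \<Rightarrow> 'a) \<Rightarrow> nat \<Rightarrow> ('a \<Rightarrow> 'a) set" where
  "W_leaf \<Delta> \<epsilon> i = reflection_group (remaining_simple \<Delta> \<epsilon> i - {\<epsilon> i})"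

text \<open>If \<open>\<epsilon> i\<close> is the only remaining simple root, it has no neighbour and the group is trivial.\<close>

definition W_leaf_neighbour ::
  "'a::euclidean_space set \<Rightarrow> (nat \<Rightarrow> 'a) \<Rightarrow> nat \<Rightarrow> ('a \<Rightarrow> 'a) set" where
  "W_leaf_neighbour \<Delta> \<epsilon> i =
     (let S = remaining_simple \<Delta> \<epsilon> i in
      if S = {\<epsilon> i} then reflection_group {}
      else reflection_group (S - {\<epsilon> i, leaf_neighbour S (\<epsilon> i)}))"

end

theory Submission
  imports Defs
begin

text \<open>Each summand is an orbit length: since \<open>\<epsilon>\<^sub>i\<close> is antidominant for the parabolic subgroup generated by
  \<open>\<Pi>\<^sup>(\<^sup>i\<^sup>) - {\<epsilon>\<^sub>i}\<close>, its stabilizer there is generated by the simple reflections fixing it, namely all but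
  that of \<open>\<epsilon>\<^sub>i'\<close>. A root with coefficient 1 at \<open>\<epsilon>\<^sub>i\<close> and the length of \<open>\<epsilon>\<^sub>i\<close> lies in this orbit: a
  representative of least height has nonpositive inner product with all of \<open>\<Pi>\<^sup>(\<^sup>i\<^sup>) - {\<epsilon>\<^sub>i}\<close>, so it
  equals \<open>\<epsilon>\<^sub>i\<close> by Cauchy--Schwarz. In the classical types all positive roots of length \<open>t\<close> supported on
  \<open>\<Pi>\<^sup>(\<^sup>i\<^sup>)\<close> with nonzero coefficient at the leaf \<open>\<epsilon>\<^sub>i\<close> have coefficient 1 there, by integrality and an
  estimate of the quadratic form. Finally, every positive root of length \<open>t\<close> involves some \<open>\<epsilon>\<^sub>i\<close>,
  because it is conjugate to a simple root within its support, and one sorts by the least such \<open>i\<close>.\<close>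

subsection \<open>Based root systems and parabolic reflection groups\<close>

text \<open>The bound 1 on the coefficient at a leaf is where the classical types matter. In
  \<open>G_2\<close> with short simple root a and long simple root b, the short root 2a + b has
  coefficient 2, and the formula would count 2 short positive roots instead of 3. The bound also
  depends on lengths: only simple roots of length \<open>t\<close> are deleted, so in types B and C
  the end node of different length stays while nodes of the path are removed, which forces their
  removal from the far end. Two gaps separate the hypotheses from this bound. Irreducibility is
  assumed for generated subsystems but needed as connectedness of sets of simple roots. And
  \<open>classical\<close> supplies a Cartan matrix for some simple system, not for the given one,
  so conjugacy of simple systems is needed. The estimate rests on z \<le> z * z for integers z: the
  quadratic form is a multiple of a sum of squares of integers, and suitable signed sums of these
  integers telescope to a coefficient or its double.\<close>

abbreviation act :: "'a::euclidean_space list \<Rightarrow> 'a \<Rightarrow> 'a" where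
  "act \<equiv> foldr reflection"

section \<open>Reflections and words in reflections as linear isometries\<close>

lemma linear_reflection: "linear (reflection \<alpha>)"
proof (rule linearI)
  fix x y :: 'a and c :: real
  have "cartan_number (x + y) \<alpha> = cartan_number x \<alpha> + cartan_number y \<alpha>"
    by (simp add: cartan_number_def inner_add_left add_divide_distrib)
  then show "reflection \<alpha> (x + y) = reflection \<alpha> x + reflection \<alpha> y"
    by (simp add: reflection_def scaleR_add_left)
  have "cartan_number (c *\<^sub>R x) \<alpha> = c * cartan_number x \<alpha>"
    by (simp add: cartan_number_def)
  then show "reflection \<alpha> (c *\<^sub>R x) = c *\<^sub>R reflection \<alpha> x"
    by (simp add: reflection_def scaleR_diff_right)
qed

lemma cartan_number_mult: "cartan_number x \<alpha> * (\<alpha> \<bullet> \<alpha>) = 2 * (x \<bullet> \<alpha>)"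
  by (cases "\<alpha> = 0") (simp_all add: cartan_number_def)

lemma inner_reflection: "reflection \<alpha> x \<bullet> reflection \<alpha> y = x \<bullet> y"
proof -
  have "reflection \<alpha> x \<bullet> reflection \<alpha> y = x \<bullet> y - cartan_number y \<alpha> * (x \<bullet> \<alpha>)
      - cartan_number x \<alpha> * (y \<bullet> \<alpha>) + cartan_number y \<alpha> * (cartan_number x \<alpha> * (\<alpha> \<bullet> \<alpha>))"
    by (simp add: reflection_def inner_diff_left inner_diff_right inner_commute)
  moreover have "cartan_number x \<alpha> * (y \<bullet> \<alpha>) = cartan_number y \<alpha> * (x \<bullet> \<alpha>)"
    by (simp add: cartan_number_def)
  ultimately show ?thesis by (simp add: cartan_number_mult)
qed

lemma norm_reflection: "norm (reflection \<alpha> x) = norm x"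
  by (simp add: norm_eq_sqrt_inner inner_reflection)

lemma reflection_reflection: "reflection \<alpha> (reflection \<alpha> x) = x"
proof (cases "\<alpha> = 0")
  case False
  then show ?thesis
    by (simp add: reflection_def cartan_number_def inner_diff_left field_simps)
qed (simp add: reflection_def)

lemma reflection_self: "\<alpha> \<noteq> 0 \<Longrightarrow> reflection \<alpha> \<alpha> = - \<alpha>"
  by (simp add: reflection_def cartan_number_def scaleR_2)

lemma reflection_orthogonal: "x \<bullet> \<alpha> = 0 \<Longrightarrow> reflection \<alpha> x = x"
  by (simp add: reflection_def cartan_number_def)

lemma linear_act: "linear (act ws)"
proof (induction ws)
  case Nil
  then show ?case using linear_id by (simp add: id_def)
next
  case (Cons \<alpha> ws)
  then show ?case
    using linear_compose[OF Cons linear_reflection, of \<alpha>] by (simp add: comp_def)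
qed

lemma inner_act: "act ws x \<bullet> act ws y = x \<bullet> y"
  by (induction ws) (simp_all add: inner_reflection)

lemma norm_act: "norm (act ws x) = norm x"
  by (simp add: norm_eq_sqrt_inner inner_act)

lemma act_minus: "act ws (- x) = - act ws x"
  by (rule linear_neg[OF linear_act])

lemma act_rev_act: "act (rev ws) (act ws x) = x"
  by (induction ws arbitrary: x) (simp_all add: reflection_reflection)

lemma act_act_rev: "act ws (act (rev ws) x) = x"
  using act_rev_act[of "rev ws"] by simp

text \<open>This is the conjugation rule w s_\<alpha> w^-1 = s_(w \<alpha>), on which the exchange
  argument rests.\<close>

lemma reflection_act: "reflection (act ws \<alpha>) (act ws x) = act ws (reflection \<alpha> x)"
proof -
  have "act ws (reflection \<alpha> x) = act ws x - cartan_number x \<alpha> *\<^sub>R act ws \<alpha>"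
    by (simp only: reflection_def[of \<alpha> x] linear_diff[OF linear_act] linear_cmul[OF linear_act])
  then show ?thesis
    by (simp add: reflection_def[of "act ws \<alpha>"] cartan_number_def inner_act)
qed

lemma bij_act: "bij (act ws)"
  by (rule o_bij[of "act (rev ws)"]) (simp_all add: fun_eq_iff act_rev_act act_act_rev)

lemma carrier_BijGroup_UNIV: "carrier (BijGroup UNIV) = {f. bij f}"
  by (auto simp: BijGroup_def Bij_def)

lemma mult_BijGroup_UNIV: "bij f \<Longrightarrow> bij g \<Longrightarrow> f \<otimes>\<^bsub>BijGroup UNIV\<^esub> g = f \<circ> g"
  by (auto simp: BijGroup_def Bij_def compose_def)

lemma one_BijGroup_UNIV: "\<one>\<^bsub>BijGroup UNIV\<^esub> = id"
  by (auto simp: BijGroup_def)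

lemma bij_reflection: "bij (reflection \<alpha>)"
  using bij_act[of "[\<alpha>]"] by (simp add: comp_def)

lemma inv_BijGroup_reflection: "inv\<^bsub>BijGroup UNIV\<^esub> (reflection \<alpha>) = reflection \<alpha>"
proof (rule group.inv_equality[OF group_BijGroup])
  show "reflection \<alpha> \<otimes>\<^bsub>BijGroup UNIV\<^esub> reflection \<alpha> = \<one>\<^bsub>BijGroup UNIV\<^esub>"
    unfolding mult_BijGroup_UNIV[OF bij_reflection bij_reflection] one_BijGroup_UNIV
    by (simp add: fun_eq_iff reflection_reflection)
qed (simp_all add: carrier_BijGroup_UNIV bij_reflection)

lemma reflection_group_eq_words: "reflection_group T = act ` lists T"
proof (intro equalityI subsetI)
  fix w assume "w \<in> reflection_group T"
  then show "w \<in> act ` lists T"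
    unfolding reflection_group_def
  proof (induction rule: generate.induct)
    case one
    have "act [] \<in> act ` lists T" by blast
    then show ?case by (simp add: one_BijGroup_UNIV id_def)
  next
    case (incl h)
    then obtain \<alpha> where "\<alpha> \<in> T" "h = act [\<alpha>]" by (auto simp: fun_eq_iff)
    moreover from this have "[\<alpha>] \<in> lists T" by simp
    ultimately show ?case by blast
  next
    case (inv h)
    then obtain \<alpha> where "\<alpha> \<in> T" "h = reflection \<alpha>" by auto
    then have "inv\<^bsub>BijGroup UNIV\<^esub> h = act [\<alpha>]"
      by (simp only: inv_BijGroup_reflection) (simp add: fun_eq_iff)
    moreover have "[\<alpha>] \<in> lists T" using \<open>\<alpha> \<in> T\<close> by simp
    ultimately show ?case by blast
  next
    case (eng g h)
    then obtain us vs where "us \<in> lists T" "vs \<in> lists T" "g = act us" "h = act vs" by blast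
    then have "g \<otimes>\<^bsub>BijGroup UNIV\<^esub> h = act (us @ vs)" "us @ vs \<in> lists T"
      by (simp_all only: mult_BijGroup_UNIV bij_act) (simp_all add: fun_eq_iff)
    then show ?case by blast
  qed
next
  fix w assume "w \<in> act ` lists T"
  then obtain ws where ws: "ws \<in> lists T" "w = act ws" by auto
  have "ws \<in> lists T \<Longrightarrow> act ws \<in> reflection_group T"
  proof (induction ws)
    case Nil
    show ?case
      unfolding reflection_group_def using generate.one[of "BijGroup UNIV"]
      by (simp add: one_BijGroup_UNIV id_def)
  next
    case (Cons \<alpha> ws)
    then have "reflection \<alpha> \<in> generate (BijGroup UNIV) (reflection ` T)"
      "act ws \<in> generate (BijGroup UNIV) (reflection ` T)"
      by (auto simp: reflection_group_def intro: generate.incl)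
    from generate.eng[OF this] show ?case
      by (simp add: reflection_group_def mult_BijGroup_UNIV bij_act bij_reflection comp_def)
  qed
  with ws show "w \<in> reflection_group T" by simp
qed

section \<open>Coefficients, positivity and heights of roots\<close>

locale based_root_system =
  fixes \<Phi> \<Delta> :: "'a::euclidean_space set"
  assumes root_system: "root_system \<Phi>" and simple_system: "simple_system \<Phi> \<Delta>"
begin

text \<open>With \<open>representation\<close> the coefficients form a total function that vanishes
  off \<Delta>, so support conditions may quantify over all vectors.\<close>

abbreviation coef :: "'a \<Rightarrow> 'a \<Rightarrow> real" where
  "coef \<equiv> representation \<Delta>"

abbreviation pos :: "'a set" where
  "pos \<equiv> positive_roots \<Phi> \<Delta>"

lemma finite_roots: "finite \<Phi>"
  and zero_notin_roots: "0 \<notin> \<Phi>"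
  and reflection_root: "\<alpha> \<in> \<Phi> \<Longrightarrow> \<beta> \<in> \<Phi> \<Longrightarrow> reflection \<alpha> \<beta> \<in> \<Phi>"
  and root_multiple: "\<alpha> \<in> \<Phi> \<Longrightarrow> c *\<^sub>R \<alpha> \<in> \<Phi> \<Longrightarrow> c = 1 \<or> c = - 1"
  and cartan_number_int: "\<alpha> \<in> \<Phi> \<Longrightarrow> \<beta> \<in> \<Phi> \<Longrightarrow> cartan_number \<beta> \<alpha> \<in> \<int>"
  using root_system unfolding root_system_def by blast+

lemma simple_subset: "\<Delta> \<subseteq> \<Phi>" and indep: "independent \<Delta>"
  using simple_system unfolding simple_system_def by blast+

lemma finite_simple: "finite \<Delta>"
  using finite_subset[OF simple_subset finite_roots] .

lemma uminus_root: "\<beta> \<in> \<Phi> \<Longrightarrow> - \<beta> \<in> \<Phi>"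
  by (metis reflection_root reflection_self zero_notin_roots)

lemma coef_sum: "coef (\<Sum>\<beta>\<in>\<Delta>. c \<beta> *\<^sub>R \<beta>) = (\<lambda>\<beta>. if \<beta> \<in> \<Delta> then c \<beta> else 0)"
proof (rule representation_eqI[OF indep])
  show "(\<Sum>\<beta>\<in>\<Delta>. c \<beta> *\<^sub>R \<beta>) \<in> span \<Delta>"
    by (intro span_sum span_scale span_base)
  show "finite {b. (if b \<in> \<Delta> then c b else 0) \<noteq> 0}"
    by (rule finite_subset[OF _ finite_simple]) (auto split: if_splits)
  show "(\<Sum>b | (if b \<in> \<Delta> then c b else 0) \<noteq> 0. (if b \<in> \<Delta> then c b else 0) *\<^sub>R b) = (\<Sum>\<beta>\<in>\<Delta>. c \<beta> *\<^sub>R \<beta>)"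
    by (rule sum.mono_neutral_cong_left[OF finite_simple]) (auto split: if_splits)
qed (auto split: if_splits)

lemma coef_notin: "\<gamma> \<notin> \<Delta> \<Longrightarrow> coef v \<gamma> = 0"
  using representation_ne_zero by blast

lemma root_cases:
  assumes "\<alpha> \<in> \<Phi>"
  shows "\<alpha> \<in> span \<Delta> \<and> ((\<forall>\<beta>. 0 \<le> coef \<alpha> \<beta>) \<or> (\<forall>\<beta>. coef \<alpha> \<beta> \<le> 0))"
proof -
  obtain c where c: "\<alpha> = (\<Sum>\<beta>\<in>\<Delta>. c \<beta> *\<^sub>R \<beta>)" "(\<forall>\<beta>\<in>\<Delta>. 0 \<le> c \<beta>) \<or> (\<forall>\<beta>\<in>\<Delta>. c \<beta> \<le> 0)"
    using assms simple_system unfolding simple_system_def by blast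
  have "\<alpha> \<in> span \<Delta>"
    unfolding c(1) by (intro span_sum span_scale span_base)
  moreover have "coef \<alpha> = (\<lambda>\<beta>. if \<beta> \<in> \<Delta> then c \<beta> else 0)"
    unfolding c(1) by (rule coef_sum)
  ultimately show ?thesis using c(2) by auto
qed

lemma root_span: "\<alpha> \<in> \<Phi> \<Longrightarrow> \<alpha> \<in> span \<Delta>"
  using root_cases by blast

lemma span_expansion: "v \<in> span \<Delta> \<Longrightarrow> (\<Sum>\<beta>\<in>\<Delta>. coef v \<beta> *\<^sub>R \<beta>) = v"
  by (rule sum_representation_eq[OF indep _ finite_simple subset_refl])

lemma pos_iff: "\<beta> \<in> pos \<longleftrightarrow> \<beta> \<in> \<Phi> \<and> (\<forall>\<gamma>. 0 \<le> coef \<beta> \<gamma>)"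
proof
  assume "\<beta> \<in> pos"
  then obtain c where c: "\<beta> \<in> \<Phi>" "\<beta> = (\<Sum>\<beta>\<in>\<Delta>. c \<beta> *\<^sub>R \<beta>)" "\<forall>\<beta>\<in>\<Delta>. 0 \<le> c \<beta>"
    unfolding positive_roots_def by blast
  have "coef \<beta> = (\<lambda>\<beta>. if \<beta> \<in> \<Delta> then c \<beta> else 0)"
    unfolding c(2) by (rule coef_sum)
  with c show "\<beta> \<in> \<Phi> \<and> (\<forall>\<gamma>. 0 \<le> coef \<beta> \<gamma>)" by simp
next
  assume *: "\<beta> \<in> \<Phi> \<and> (\<forall>\<gamma>. 0 \<le> coef \<beta> \<gamma>)"
  then have "\<beta> = (\<Sum>\<gamma>\<in>\<Delta>. coef \<beta> \<gamma> *\<^sub>R \<gamma>)"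
    using span_expansion root_span by metis
  with * show "\<beta> \<in> pos" unfolding positive_roots_def by blast
qed

lemma coef_uminus: "v \<in> span \<Delta> \<Longrightarrow> coef (- v) \<gamma> = - coef v \<gamma>"
  by (simp add: representation_neg[OF indep])

lemma coef_simple: "\<alpha> \<in> \<Delta> \<Longrightarrow> coef \<alpha> = (\<lambda>\<gamma>. if \<gamma> = \<alpha> then 1 else 0)"
  by (rule representation_basis[OF indep])

lemma coef_reflection:
  assumes "v \<in> span \<Delta>" "\<alpha> \<in> \<Delta>"
  shows "coef (reflection \<alpha> v) \<gamma> = coef v \<gamma> - (if \<gamma> = \<alpha> then cartan_number v \<alpha> else 0)"
proof -
  have "\<alpha> \<in> span \<Delta>" "cartan_number v \<alpha> *\<^sub>R \<alpha> \<in> span \<Delta>"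
    using assms by (auto intro: span_base span_scale)
  then show ?thesis
    using assms unfolding reflection_def
    by (simp add: representation_diff[OF indep] representation_scale[OF indep] coef_simple)
qed

lemma simple_root: "\<alpha> \<in> \<Delta> \<Longrightarrow> \<alpha> \<in> \<Phi>" using simple_subset by blast

lemma simple_nonzero: "\<alpha> \<in> \<Delta> \<Longrightarrow> \<alpha> \<noteq> 0" using simple_root zero_notin_roots by blast

lemma simple_pos: "\<alpha> \<in> \<Delta> \<Longrightarrow> \<alpha> \<in> pos"
  by (auto simp: pos_iff simple_root coef_simple)

lemma pos_root: "\<beta> \<in> pos \<Longrightarrow> \<beta> \<in> \<Phi>" by (simp add: pos_iff)

lemma pos_or_neg: "\<beta> \<in> \<Phi> \<Longrightarrow> \<beta> \<in> pos \<or> - \<beta> \<in> pos"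
  using root_cases[of \<beta>] by (auto simp: pos_iff uminus_root coef_uminus)

lemma coef_eq_0_imp: "v \<in> span \<Delta> \<Longrightarrow> (\<And>\<gamma>. coef v \<gamma> = 0) \<Longrightarrow> v = 0"
  using span_expansion[of v] by simp

lemma not_pos_and_neg: "\<beta> \<in> pos \<Longrightarrow> - \<beta> \<notin> pos"
proof
  assume "\<beta> \<in> pos" "- \<beta> \<in> pos"
  then have "\<And>\<gamma>. coef \<beta> \<gamma> = 0"
    by (metis coef_uminus neg_0_le_iff_le order_antisym pos_iff root_span)
  then show False
    using \<open>\<beta> \<in> pos\<close> coef_eq_0_imp pos_root root_span zero_notin_roots by metis
qed

lemma pos_if_coef_pos: "\<beta> \<in> \<Phi> \<Longrightarrow> 0 < coef \<beta> \<gamma> \<Longrightarrow> \<beta> \<in> pos"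
  using root_cases[of \<beta>] by (auto simp: pos_iff) (metis leD)

text \<open>Reducedness enters here: the root is a multiple of \<alpha>, and the only such roots are
  \<alpha> and its negative.\<close>

lemma pos_multiple_of_simple:
  assumes "\<beta> \<in> pos" "\<alpha> \<in> \<Delta>" "\<And>\<gamma>. \<gamma> \<noteq> \<alpha> \<Longrightarrow> coef \<beta> \<gamma> = 0"
  shows "\<beta> = \<alpha>"
proof -
  have "\<beta> = (\<Sum>\<gamma>\<in>\<Delta>. coef \<beta> \<gamma> *\<^sub>R \<gamma>)"
    using assms(1) pos_root root_span span_expansion by metis
  also have "\<dots> = (\<Sum>\<gamma>\<in>\<Delta>. if \<gamma> = \<alpha> then coef \<beta> \<alpha> *\<^sub>R \<alpha> else 0)"
    by (rule sum.cong) (auto simp: assms(3))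
  also have "\<dots> = coef \<beta> \<alpha> *\<^sub>R \<alpha>"
    using assms(2) finite_simple by simp
  finally have eq: "\<beta> = coef \<beta> \<alpha> *\<^sub>R \<alpha>" .
  then have "coef \<beta> \<alpha> = 1 \<or> coef \<beta> \<alpha> = -1"
    using root_multiple[OF simple_root[OF assms(2)], of "coef \<beta> \<alpha>"] pos_root[OF assms(1)]
    by (metis)
  moreover have "coef \<beta> \<alpha> \<ge> 0" using assms(1) pos_iff by blast
  ultimately show ?thesis using eq by auto
qed

text \<open>The reflection changes only the coefficient at \<alpha>. Some other coefficient of
  \<beta> is positive and survives, and one positive coefficient already makes a root
  positive.\<close>

lemma reflection_pos:
  assumes "\<beta> \<in> pos" "\<alpha> \<in> \<Delta>" "\<beta> \<noteq> \<alpha>"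
  shows "reflection \<alpha> \<beta> \<in> pos"
proof -
  obtain \<gamma> where "\<gamma> \<noteq> \<alpha>" "coef \<beta> \<gamma> \<noteq> 0"
    using pos_multiple_of_simple assms by blast
  moreover have "coef \<beta> \<gamma> \<ge> 0" using assms(1) pos_iff by blast
  ultimately have "coef (reflection \<alpha> \<beta>) \<gamma> > 0"
    using assms by (simp add: coef_reflection root_span pos_root)
  then show ?thesis
    by (rule pos_if_coef_pos[OF reflection_root[OF simple_root[OF assms(2)] pos_root[OF assms(1)]]])
qed

text \<open>The coefficient at \<beta> of the positive root
  \<open>reflection \<beta> \<alpha>\<close> is minus the Cartan number, so the latter cannot be
  positive.\<close>

lemma simple_obtuse:
  assumes "\<alpha> \<in> \<Delta>" "\<beta> \<in> \<Delta>" "\<alpha> \<noteq> \<beta>"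
  shows "\<alpha> \<bullet> \<beta> \<le> 0"
proof -
  have "reflection \<beta> \<alpha> \<in> pos" using assms by (simp add: reflection_pos simple_pos)
  then have "0 \<le> coef (reflection \<beta> \<alpha>) \<beta>" by (simp add: pos_iff)
  then have "cartan_number \<alpha> \<beta> \<le> 0"
    using assms by (simp add: coef_reflection span_base coef_simple split: if_splits)
  moreover have "\<beta> \<bullet> \<beta> > 0" using assms simple_nonzero by simp
  ultimately show ?thesis
    unfolding cartan_number_def by (simp add: divide_le_0_iff)
qed

lemma act_root: "set ws \<subseteq> \<Delta> \<Longrightarrow> \<beta> \<in> \<Phi> \<Longrightarrow> act ws \<beta> \<in> \<Phi>"
  by (induction ws) (auto intro: reflection_root simple_root)

lemma coef_act:
  "set ws \<subseteq> \<Delta> \<Longrightarrow> v \<in> span \<Delta> \<Longrightarrow> \<gamma> \<notin> set ws \<Longrightarrow> act ws v \<in> span \<Delta> \<and> coef (act ws v) \<gamma> = coef v \<gamma>"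
proof (induction ws)
  case (Cons \<alpha> ws)
  then have "act ws v \<in> span \<Delta>" "\<alpha> \<in> span \<Delta>" by (auto intro: span_base)
  then have "reflection \<alpha> (act ws v) \<in> span \<Delta>"
    unfolding reflection_def by (intro span_diff span_scale)
  with Cons show ?case by (simp add: coef_reflection)
qed simp

definition height :: "'a \<Rightarrow> real" where
  "height v = (\<Sum>\<gamma>\<in>\<Delta>. coef v \<gamma>)"

lemma height_reflection:
  assumes "v \<in> span \<Delta>" "\<alpha> \<in> \<Delta>"
  shows "height (reflection \<alpha> v) = height v - cartan_number v \<alpha>"
  using assms finite_simple by (simp add: height_def coef_reflection sum_subtractf)

text \<open>Heights are merely real numbers here, since integrality of coefficients is derived only
  later. Well-foundedness comes instead from counting the finitely many positive roots of smaller
  height.\<close>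

lemma height_induct [consumes 1, case_names less]:
  assumes "\<beta> \<in> pos"
    and step: "\<And>\<beta>. \<beta> \<in> pos \<Longrightarrow> (\<And>\<gamma>. \<gamma> \<in> pos \<Longrightarrow> height \<gamma> < height \<beta> \<Longrightarrow> P \<gamma>) \<Longrightarrow> P \<beta>"
  shows "P \<beta>"
  using assms(1)
proof (induction "card {\<delta> \<in> pos. height \<delta> < height \<beta>}" arbitrary: \<beta> rule: less_induct)
  case less
  show ?case
  proof (rule step[OF less.prems])
    fix \<gamma> assume \<gamma>: "\<gamma> \<in> pos" "height \<gamma> < height \<beta>"
    have "finite pos" by (rule finite_subset[OF _ finite_roots]) (auto simp: pos_iff)
    then have "card {\<delta> \<in> pos. height \<delta> < height \<gamma>} < card {\<delta> \<in> pos. height \<delta> < height \<beta>}"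
      by (intro psubset_card_mono) (use \<gamma> in auto)
    then show "P \<gamma>" using less.hyps \<gamma> by blast
  qed
qed

text \<open>Expanding \<beta> \<bullet> \<beta> > 0 along the simple roots yields a \<gamma> in the
  support of \<beta> with \<beta> \<bullet> \<gamma> > 0; reflecting in it lowers the height and
  keeps the support in \<open>T\<close>. Confining both the word and the simple root to
  \<open>T\<close> is what later shows that a root of length \<open>t\<close> has a simple root of
  length \<open>t\<close> in its support.\<close>

lemma pos_conj_simple:
  assumes "\<beta> \<in> pos" "T \<subseteq> \<Delta>" "\<And>\<gamma>. \<gamma> \<notin> T \<Longrightarrow> coef \<beta> \<gamma> = 0"
  shows "\<exists>\<alpha>\<in>T. \<exists>ws\<in>lists T. \<beta> = act ws \<alpha>"
  using assms(1,3)
proof (induction rule: height_induct)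
  case (less \<beta>)
  have span: "\<beta> \<in> span \<Delta>" using less.hyps pos_root root_span by blast
  have "0 < \<beta> \<bullet> \<beta>"
    using less.hyps pos_root zero_notin_roots by auto
  also have "\<beta> \<bullet> \<beta> = (\<Sum>\<gamma>\<in>\<Delta>. coef \<beta> \<gamma> * (\<beta> \<bullet> \<gamma>))"
    using span_expansion[OF span] inner_sum_right[of \<beta> "\<lambda>\<gamma>. coef \<beta> \<gamma> *\<^sub>R \<gamma>" \<Delta>] by simp
  finally obtain \<gamma> where \<gamma>: "\<gamma> \<in> \<Delta>" "coef \<beta> \<gamma> * (\<beta> \<bullet> \<gamma>) > 0"
    by (meson not_le sum_nonpos)
  then have "\<beta> \<bullet> \<gamma> > 0"
    using less.hyps by (auto simp: pos_iff zero_less_mult_iff dest: spec[of _ \<gamma>])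
  have "\<gamma> \<in> T"
    using \<gamma>(2) less.prems[of \<gamma>] by (cases "\<gamma> \<in> T") simp_all
  show ?case
  proof (cases "\<beta> = \<gamma>")
    case True
    then show ?thesis using \<open>\<gamma> \<in> T\<close> by (intro bexI[of _ \<gamma>] bexI[of _ "[]"]) auto
  next
    case False
    let ?\<beta> = "reflection \<gamma> \<beta>"
    have 1: "?\<beta> \<in> pos" using reflection_pos less.hyps \<gamma> False by blast
    have "cartan_number \<beta> \<gamma> > 0"
      unfolding cartan_number_def using \<open>\<beta> \<bullet> \<gamma> > 0\<close> simple_nonzero[OF \<gamma>(1)] by simp
    then have 2: "height ?\<beta> < height \<beta>"
      using height_reflection[OF span \<gamma>(1)] by simp
    have 3: "\<And>\<delta>. \<delta> \<notin> T \<Longrightarrow> coef ?\<beta> \<delta> = 0"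
      using less.prems \<gamma> \<open>\<gamma> \<in> T\<close> by (auto simp: coef_reflection span)
    from less.IH[OF 1 2 3] obtain \<alpha> ws where "\<alpha> \<in> T" "ws \<in> lists T" "?\<beta> = act ws \<alpha>" by blast
    then have "\<beta> = act (\<gamma> # ws) \<alpha>" by (simp add: reflection_reflection flip: \<open>?\<beta> = _\<close>)
    moreover have "\<gamma> # ws \<in> lists T" using \<open>ws \<in> lists T\<close> \<open>\<gamma> \<in> T\<close> by simp
    ultimately show ?thesis using \<open>\<alpha> \<in> T\<close> by blast
  qed
qed

lemma coef_1_conj:
  assumes "\<beta> \<in> pos" "S \<subseteq> \<Delta>" "\<epsilon> \<in> S" "\<And>\<gamma>. \<gamma> \<notin> S \<Longrightarrow> coef \<beta> \<gamma> = 0"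
    and "coef \<beta> \<epsilon> = 1" "norm \<beta> = norm \<epsilon>"
  shows "\<exists>ws\<in>lists (S - {\<epsilon>}). \<beta> = act ws \<epsilon>"
  using assms(1,4-)
proof (induction rule: height_induct)
  case (less \<beta>)
  have span: "\<beta> \<in> span \<Delta>" using less.hyps pos_root root_span by blast
  show ?case
  proof (cases "\<exists>\<gamma>\<in>S - {\<epsilon>}. \<beta> \<bullet> \<gamma> > 0")
    case True
    then obtain \<gamma> where \<gamma>: "\<gamma> \<in> S" "\<gamma> \<noteq> \<epsilon>" "\<beta> \<bullet> \<gamma> > 0" "\<gamma> \<in> \<Delta>" using assms(2) by blast
    let ?\<beta> = "reflection \<gamma> \<beta>"
    \<comment> \<open>Since \<gamma> differs from \<epsilon>, the coefficient at \<epsilon> is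
      untouched, and its value 1 certifies that the reflected root is again positive.\<close>
    have "coef ?\<beta> \<epsilon> = 1" using \<gamma> less.prems by (simp add: coef_reflection span)
    moreover from this have 1: "?\<beta> \<in> pos"
      using pos_if_coef_pos[of ?\<beta> \<epsilon>] less.hyps \<gamma> by (simp add: reflection_root simple_root pos_root)
    have "cartan_number \<beta> \<gamma> > 0"
      unfolding cartan_number_def using \<open>\<beta> \<bullet> \<gamma> > 0\<close> simple_nonzero[OF \<gamma>(4)] by simp
    then have 2: "height ?\<beta> < height \<beta>"
      using height_reflection[OF span \<gamma>(4)] by simp
    have 3: "\<And>\<delta>. \<delta> \<notin> S \<Longrightarrow> coef ?\<beta> \<delta> = 0"
      using less.prems \<gamma> by (auto simp: coef_reflection span)
    ultimately obtain ws where "ws \<in> lists (S - {\<epsilon>})" "?\<beta> = act ws \<epsilon>"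
      using less.IH[OF 1 2 3] less.prems by (auto simp: norm_reflection)
    then have "\<beta> = act (\<gamma> # ws) \<epsilon>" by (simp add: reflection_reflection flip: \<open>?\<beta> = _\<close>)
    moreover have "\<gamma> # ws \<in> lists (S - {\<epsilon>})" using \<open>ws \<in> _\<close> \<gamma> by simp
    ultimately show ?thesis by blast
  next
    case False
    have fS: "finite S" using assms(2) finite_simple finite_subset by blast
    \<comment> \<open>Only one factor is expanded: the term at \<epsilon> has coefficient exactly 1,
      and all other terms are nonpositive in this case.\<close>
    have "\<beta> \<bullet> \<beta> = (\<Sum>\<gamma>\<in>\<Delta>. coef \<beta> \<gamma> * (\<beta> \<bullet> \<gamma>))"
      using span_expansion[OF span] inner_sum_right[of \<beta> "\<lambda>\<gamma>. coef \<beta> \<gamma> *\<^sub>R \<gamma>" \<Delta>] by simp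
    also have "\<dots> = (\<Sum>\<gamma>\<in>S. coef \<beta> \<gamma> * (\<beta> \<bullet> \<gamma>))"
      by (rule sum.mono_neutral_right) (use assms(2) less.prems finite_simple in auto)
    also have "\<dots> = \<beta> \<bullet> \<epsilon> + (\<Sum>\<gamma>\<in>S - {\<epsilon>}. coef \<beta> \<gamma> * (\<beta> \<bullet> \<gamma>))"
      using assms(3) fS less.prems by (simp add: sum.remove)
    also have "(\<Sum>\<gamma>\<in>S - {\<epsilon>}. coef \<beta> \<gamma> * (\<beta> \<bullet> \<gamma>)) \<le> 0"
      by (rule sum_nonpos) (use False less.hyps in \<open>auto simp: pos_iff mult_nonneg_nonpos not_less\<close>)
    finally have "\<beta> \<bullet> \<beta> \<le> \<beta> \<bullet> \<epsilon>" by simp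
    \<comment> \<open>Vectors of equal length satisfying this inequality coincide, by Cauchy--Schwarz.\<close>
    then have "(\<beta> - \<epsilon>) \<bullet> (\<beta> - \<epsilon>) \<le> 0"
      using less.prems(3) by (simp add: inner_diff_left inner_diff_right inner_commute norm_eq)
    then have "\<beta> = \<epsilon>"
      by (metis inner_eq_zero_iff inner_ge_zero order_antisym right_minus_eq)
    then show ?thesis by (intro bexI[of _ "[]"]) auto
  qed
qed

section \<open>Exchange condition, stabilizers and orbit counting\<close>

text \<open>Applying the letters of \<open>ws\<close> to \<gamma> from right to left, the root
  ceases to be positive at some letter \<delta>. By \<open>reflection_pos\<close> it equals \<delta>
  at that moment, and by the conjugation rule s_\<gamma> then cancels this letter.\<close>

lemma exchange:
  assumes "set ws \<subseteq> \<Delta>" "\<gamma> \<in> \<Delta>" "act ws \<gamma> \<notin> pos"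
  shows "\<exists>us. set us \<subseteq> set ws \<and> length us < length ws \<and> (\<forall>x. act ws (reflection \<gamma> x) = act us x)"
  using assms
proof (induction ws)
  case Nil
  then show ?case using simple_pos by auto
next
  case (Cons \<delta> vs)
  show ?case
  proof (cases "act vs \<gamma> \<in> pos")
    case True
    have "act vs \<gamma> = \<delta>"
    proof (rule ccontr)
      assume "act vs \<gamma> \<noteq> \<delta>"
      with True Cons.prems have "reflection \<delta> (act vs \<gamma>) \<in> pos" by (simp add: reflection_pos)
      with Cons.prems show False by simp
    qed
    then have "act (\<delta> # vs) (reflection \<gamma> x) = act vs x" for x
      using reflection_act[of vs \<gamma> x] reflection_reflection[of \<delta> "act vs x"] by simp
    then show ?thesis by (intro exI[of _ vs]) auto
  next
    case False
    with Cons obtain us where "set us \<subseteq> set vs" "length us < length vs"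
      "\<forall>x. act vs (reflection \<gamma> x) = act us x" by auto
    then show ?thesis by (intro exI[of _ "\<delta> # us"]) auto
  qed
qed

text \<open>Let \<gamma> be the last letter and \<open>us\<close> the rest. If \<open>us\<close>
  makes \<gamma> nonpositive, \<open>exchange\<close> shortens the word. Otherwise
  \<open>act us \<gamma>\<close> is a nonnegative combination of \<open>J\<close>, so its inner
  product with the antidominant \<epsilon> is at most 0; but this inner product is -(\<gamma>
  \<bullet> \<epsilon>), which is at least 0. Hence \<gamma> is orthogonal to \<epsilon> and can be
  split off.\<close>

lemma stabilizer_word:
  assumes "set ws \<subseteq> J" "J \<subseteq> \<Delta>" "\<And>\<gamma>. \<gamma> \<in> J \<Longrightarrow> \<epsilon> \<bullet> \<gamma> \<le> 0" "act ws \<epsilon> = \<epsilon>"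
  shows "act ws \<in> reflection_group {\<gamma>\<in>J. \<gamma> \<bullet> \<epsilon> = 0}"
  using assms(1,4)
proof (induction "length ws" arbitrary: ws rule: less_induct)
  case less
  show ?case
  proof (cases ws rule: rev_cases)
    case Nil
    have "act [] \<in> act ` lists {\<gamma>\<in>J. \<gamma> \<bullet> \<epsilon> = 0}" by blast
    with Nil show ?thesis by (simp only: reflection_group_eq_words)
  next
    case (snoc us \<gamma>)
    then have us: "set us \<subseteq> \<Delta>" "\<gamma> \<in> \<Delta>" "\<gamma> \<in> J" "set us \<subseteq> J" using less.prems assms(2) by auto
    have ws: "act ws x = act us (reflection \<gamma> x)" for x by (simp add: snoc)
    show ?thesis
    proof (cases "act us \<gamma> \<in> pos")
      case False
      then obtain vs where "set vs \<subseteq> set us" "length vs < length us" "\<forall>x. act us (reflection \<gamma> x) = act vs x"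
        using exchange us by meson
      then have "act ws = act vs" "length vs < length ws" "set vs \<subseteq> J" using ws snoc us by auto
      then show ?thesis using less.hyps[of vs] less.prems by auto
    next
      case True
      have "act us \<gamma> \<bullet> \<epsilon> \<le> 0"
      proof -
        have c: "coef (act us \<gamma>) \<delta> = 0" if "\<delta> \<notin> J" for \<delta>
        proof -
          have "\<delta> \<notin> set us" "\<delta> \<noteq> \<gamma>" using us that by auto
          with us show ?thesis using coef_act[of us \<gamma> \<delta>] by (simp add: coef_simple span_base)
        qed
        have "act us \<gamma> \<bullet> \<epsilon> = (\<Sum>\<delta>\<in>\<Delta>. coef (act us \<gamma>) \<delta> *\<^sub>R \<delta>) \<bullet> \<epsilon>"
          using True by (simp add: span_expansion root_span pos_root)
        also have "\<dots> = (\<Sum>\<delta>\<in>\<Delta>. coef (act us \<gamma>) \<delta> * (\<delta> \<bullet> \<epsilon>))"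
          by (simp add: inner_sum_left)
        also have "\<dots> \<le> 0"
          by (rule sum_nonpos)
            (metis True assms(3) c inner_commute mult_nonneg_nonpos mult_zero_left order_refl pos_iff)
        finally show ?thesis .
      qed
      \<comment> \<open>The word \<open>ws\<close> is an isometry fixing \<epsilon>, and it sends
        \<gamma> to \<open>- act us \<gamma>\<close>.\<close>
      moreover have "act us \<gamma> \<bullet> \<epsilon> = - (\<gamma> \<bullet> \<epsilon>)"
      proof -
        have "act ws \<gamma> = - act us \<gamma>"
          using us simple_nonzero by (simp add: ws reflection_self act_minus)
        moreover have "act ws \<gamma> \<bullet> \<epsilon> = \<gamma> \<bullet> \<epsilon>"
          using inner_act[of ws \<gamma> \<epsilon>] less.prems by simp
        ultimately show ?thesis by simp
      qed
      ultimately have g: "\<gamma> \<bullet> \<epsilon> = 0"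
        using assms(3)[of \<gamma>] us by (simp add: inner_commute)
      then have "reflection \<gamma> \<epsilon> = \<epsilon>" by (simp add: reflection_orthogonal inner_commute)
      then have "act us \<epsilon> = \<epsilon>" using less.prems ws by metis
      then have "act us \<in> reflection_group {\<gamma>\<in>J. \<gamma> \<bullet> \<epsilon> = 0}"
        using less.hyps[of us] snoc us by auto
      then obtain vs where "vs \<in> lists {\<gamma>\<in>J. \<gamma> \<bullet> \<epsilon> = 0}" "act us = act vs"
        by (auto simp: reflection_group_eq_words)
      then have "act ws = act (vs @ [\<gamma>])" "vs @ [\<gamma>] \<in> lists {\<gamma>\<in>J. \<gamma> \<bullet> \<epsilon> = 0}"
        using ws g us by auto
      then show ?thesis unfolding reflection_group_eq_words by blast
    qed
  qed
qed

text \<open>The roots need not span the space, but every group element fixes the orthogonal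
  complement of \<Delta> pointwise, so it is determined by its values on \<Delta>, which lie in the
  finite set \<Phi>. Finiteness makes the denominators of the summands nonzero.\<close>

lemma finite_reflection_group:
  assumes "J \<subseteq> \<Delta>"
  shows "finite (reflection_group J)"
proof -
  have fixed: "act ws q = q" if "set ws \<subseteq> \<Delta>" "\<And>\<gamma>. \<gamma> \<in> \<Delta> \<Longrightarrow> q \<bullet> \<gamma> = 0" for ws q
    using that by (induction ws) (auto simp: reflection_orthogonal)
  have "inj_on (\<lambda>w. restrict w \<Delta>) (reflection_group J)"
  proof (rule inj_onI)
    fix v w assume "v \<in> reflection_group J" "w \<in> reflection_group J" and
      eq: "restrict v \<Delta> = restrict w \<Delta>"
    then obtain us ws where us: "v = act us" "w = act ws" "us \<in> lists J" "ws \<in> lists J"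
      by (auto simp: reflection_group_eq_words)
    show "v = w"
    proof
      fix x :: 'a
      obtain p q where pq: "p \<in> span \<Delta>" "\<And>\<gamma>. \<gamma> \<in> span \<Delta> \<Longrightarrow> orthogonal q \<gamma>" "x = p + q"
        using orthogonal_subspace_decomp_exists[of \<Delta> x] by blast
      have "v p = w p"
        unfolding us
        by (rule linear_eq_on_span[OF linear_act linear_act _ pq(1)])
          (metis eq restrict_apply' us(1,2))
      moreover have "v q = q" "w q = q"
        unfolding us
        by (rule fixed; use us assms pq in \<open>auto simp: orthogonal_def span_base\<close>)+
      moreover have "v (p + q) = v p + v q" "w (p + q) = w p + w q"
        unfolding us by (rule linear_add[OF linear_act])+
      ultimately show "v x = w x" by (simp add: pq)
    qed
  qed
  moreover have "(\<lambda>w. restrict w \<Delta>) ` reflection_group J \<subseteq> \<Delta> \<rightarrow>\<^sub>E \<Phi>"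
  proof
    fix f assume "f \<in> (\<lambda>w. restrict w \<Delta>) ` reflection_group J"
    then obtain ws where "f = restrict (act ws) \<Delta>" "ws \<in> lists J"
      by (auto simp: reflection_group_eq_words)
    moreover from this have "set ws \<subseteq> \<Delta>" using assms by (auto simp: in_lists_conv_set)
    ultimately show "f \<in> \<Delta> \<rightarrow>\<^sub>E \<Phi>" using act_root simple_root by auto
  qed
  moreover have "finite (\<Delta> \<rightarrow>\<^sub>E \<Phi>)"
    by (simp add: finite_PiE finite_roots finite_simple)
  ultimately show ?thesis
    by (meson finite_imageD finite_subset)
qed

text \<open>Antidominance of \<epsilon> is used only to identify the stabilizer as a parabolic
  subgroup, in \<open>stab\<close>; the remainder is the orbit-stabilizer count.\<close>

lemma orbit_stabilizer:
  assumes "J \<subseteq> \<Delta>" "\<And>\<gamma>. \<gamma> \<in> J \<Longrightarrow> \<epsilon> \<bullet> \<gamma> \<le> 0"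
  shows "card (reflection_group J) =
    card ((\<lambda>w. w \<epsilon>) ` reflection_group J) * card (reflection_group {\<gamma>\<in>J. \<gamma> \<bullet> \<epsilon> = 0})"
proof -
  let ?W = "reflection_group J" and ?K = "reflection_group {\<gamma>\<in>J. \<gamma> \<bullet> \<epsilon> = 0}"
  let ?O = "(\<lambda>w. w \<epsilon>) ` ?W"
  have stab: "?K = {w \<in> ?W. w \<epsilon> = \<epsilon>}"
  proof (intro equalityI subsetI)
    fix w assume "w \<in> ?K"
    then obtain ws where ws: "w = act ws" "ws \<in> lists {\<gamma>\<in>J. \<gamma> \<bullet> \<epsilon> = 0}"
      by (auto simp: reflection_group_eq_words)
    from ws(2) have "act ws \<epsilon> = \<epsilon>"
      by (induction ws) (auto simp: reflection_orthogonal inner_commute)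
    moreover have "ws \<in> lists J" using ws(2) by auto
    ultimately show "w \<in> {w \<in> ?W. w \<epsilon> = \<epsilon>}" using ws(1) by (auto simp: reflection_group_eq_words)
  next
    fix w assume "w \<in> {w \<in> ?W. w \<epsilon> = \<epsilon>}"
    then obtain ws where "w = act ws" "ws \<in> lists J" "act ws \<epsilon> = \<epsilon>"
      by (auto simp: reflection_group_eq_words)
    then show "w \<in> ?K" using stabilizer_word[OF _ assms(1,2), of ws] by (auto simp: in_lists_conv_set)
  qed
  \<comment> \<open>The choice \<open>g\<close> selects a word carrying \<epsilon> to each point of
    its orbit, that is, a transversal of the cosets of \<open>?K\<close>; every element factors
    uniquely through it.\<close>
  have "\<forall>\<beta>\<in>?O. \<exists>ws\<in>lists J. act ws \<epsilon> = \<beta>" by (auto simp: reflection_group_eq_words)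
  then obtain g where g: "\<And>\<beta>. \<beta> \<in> ?O \<Longrightarrow> g \<beta> \<in> lists J \<and> act (g \<beta>) \<epsilon> = \<beta>" by metis
  have "bij_betw (\<lambda>(\<beta>, k). act (g \<beta>) \<circ> k) (?O \<times> ?K) ?W"
  proof (rule bij_betwI[where g = "\<lambda>w. (w \<epsilon>, act (rev (g (w \<epsilon>))) \<circ> w)"])
    show "(\<lambda>(\<beta>, k). act (g \<beta>) \<circ> k) \<in> ?O \<times> ?K \<rightarrow> ?W"
    proof clarify
      fix w k assume "w \<in> ?W" "k \<in> ?K"
      then have gw: "g (w \<epsilon>) \<in> lists J" "k \<in> ?W" using g stab by blast+
      then obtain ks where ks: "k = act ks" "ks \<in> lists J" by (auto simp: reflection_group_eq_words)
      then have "act (g (w \<epsilon>)) \<circ> k = act (g (w \<epsilon>) @ ks)" by auto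
      moreover have "g (w \<epsilon>) @ ks \<in> lists J" using gw ks by simp
      ultimately show "act (g (w \<epsilon>)) \<circ> k \<in> ?W" unfolding reflection_group_eq_words by blast
    qed
    show "(\<lambda>w. (w \<epsilon>, act (rev (g (w \<epsilon>))) \<circ> w)) \<in> ?W \<rightarrow> ?O \<times> ?K"
    proof
      fix w assume w: "w \<in> ?W"
      then have gw: "g (w \<epsilon>) \<in> lists J" "act (g (w \<epsilon>)) \<epsilon> = w \<epsilon>" using g by blast+
      obtain ks where ks: "w = act ks" "ks \<in> lists J" using w by (auto simp: reflection_group_eq_words)
      then have "act (rev (g (w \<epsilon>))) \<circ> w = act (rev (g (w \<epsilon>)) @ ks)" by auto
      moreover have "rev (g (w \<epsilon>)) @ ks \<in> lists J" using gw ks by (auto simp: in_lists_conv_set)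
      ultimately have "act (rev (g (w \<epsilon>))) \<circ> w \<in> ?W" unfolding reflection_group_eq_words by blast
      moreover have "(act (rev (g (w \<epsilon>))) \<circ> w) \<epsilon> = \<epsilon>"
        using act_rev_act[of "g (w \<epsilon>)" \<epsilon>] gw by simp
      ultimately show "(w \<epsilon>, act (rev (g (w \<epsilon>))) \<circ> w) \<in> ?O \<times> ?K" using w stab by blast
    qed
    show "(\<lambda>w. (w \<epsilon>, act (rev (g (w \<epsilon>))) \<circ> w)) (case x of (\<beta>, k) \<Rightarrow> act (g \<beta>) \<circ> k) = x"
      if x_in: "x \<in> ?O \<times> ?K" for x
    proof -
      obtain \<beta> k where x: "x = (\<beta>, k)" "\<beta> \<in> ?O" "k \<in> ?K" using x_in by (cases x) blast
      then have "k \<epsilon> = \<epsilon>" "act (g \<beta>) \<epsilon> = \<beta>" using g stab by blast+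
      then show ?thesis by (simp add: x(1) act_rev_act fun_eq_iff)
    qed
    show "(case (w \<epsilon>, act (rev (g (w \<epsilon>))) \<circ> w) of (\<beta>, k) \<Rightarrow> act (g \<beta>) \<circ> k) = w" for w
      by (simp add: act_act_rev fun_eq_iff)
  qed
  from bij_betw_same_card[OF this] show ?thesis
    by (simp only: card_cartesian_product)
qed

end

subsection \<open>Irreducibility and conjugacy of simple systems\<close>

lemma inner_span_eq_0:
  assumes "\<And>a b. a \<in> A \<Longrightarrow> b \<in> B \<Longrightarrow> a \<bullet> b = 0" "x \<in> span A" "y \<in> span B"
  shows "x \<bullet> y = 0"
proof -
  have "orthogonal a y" if "a \<in> A" for a
    by (rule orthogonal_to_span[OF assms(3)]) (simp add: orthogonal_def assms(1) that)
  then have "orthogonal y x"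
    by (intro orthogonal_to_span[OF assms(2)]) (simp add: orthogonal_commute)
  then show ?thesis by (simp add: orthogonal_def inner_commute)
qed

lemma reflection_in_span: "\<alpha> \<in> span A \<Longrightarrow> x \<in> span A \<Longrightarrow> reflection \<alpha> x \<in> span A"
  unfolding reflection_def by (intro span_diff span_scale)

text \<open>Irreducibility in its working form, as connectedness: a predicate that separates two
  elements of \<open>T\<close> is crossed by an edge, that is, by a nonorthogonal pair.\<close>

lemma irreducible_cut:
  assumes "irreducible_rs T" "u \<in> T" "v \<in> T" "Q u" "\<not> Q v"
  shows "\<exists>x\<in>T. \<exists>y\<in>T. Q x \<and> \<not> Q y \<and> x \<bullet> y \<noteq> 0"
proof (rule ccontr)
  assume *: "\<not> ?thesis"
  have "\<not> irreducible_rs T"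
    unfolding irreducible_rs_def not_not
    by (rule exI[of _ "{x\<in>T. Q x}"], rule exI[of _ "{x\<in>T. \<not> Q x}"]) (use assms * in blast)
  with assms show False by blast
qed

text \<open>This passes from the hypothesis on generated subsystems to connectedness of the diagram.
  If \<open>T\<close> splits orthogonally into \<open>A\<close> and \<open>B\<close>, the roots
  lying in \<open>span A\<close> or in \<open>span B\<close> form a root system containing
  \<open>T\<close>; it contains the generated subsystem, which then splits as well.\<close>

lemma irreducible_generating_set:
  assumes "root_system \<Phi>" "T \<subseteq> \<Phi>" "irreducible_rs (generated_subsystem \<Phi> T)"
  shows "irreducible_rs T"
  unfolding irreducible_rs_def
proof (intro notI, elim exE conjE)
  fix A B assume AB: "A \<noteq> {}" "B \<noteq> {}" "A \<inter> B = {}" "A \<union> B = T" "\<forall>\<alpha>\<in>A. \<forall>\<beta>\<in>B. \<alpha> \<bullet> \<beta> = 0"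
  let ?H = "generated_subsystem \<Phi> T"
  let ?\<Psi> = "{\<beta>\<in>\<Phi>. \<beta> \<in> span A \<or> \<beta> \<in> span B}"
  have orth: "x \<bullet> y = 0" "y \<bullet> x = 0" if "x \<in> span A" "y \<in> span B" for x y
    using inner_span_eq_0[of A B x y] that AB(5) by (simp_all add: inner_commute)
  have refl: "reflection \<alpha> \<beta> \<in> ?\<Psi>" if "\<alpha> \<in> ?\<Psi>" "\<beta> \<in> ?\<Psi>" for \<alpha> \<beta>
  proof -
    have "reflection \<alpha> \<beta> \<in> \<Phi>" using that assms(1) unfolding root_system_def by blast
    \<comment> \<open>Either both roots lie in the same span, which is closed under the reflection,
      or they are orthogonal and the reflection fixes \<beta>.\<close>
    moreover have "\<alpha> \<in> span A \<and> \<beta> \<in> span A \<or> \<alpha> \<in> span B \<and> \<beta> \<in> span B \<or> \<beta> \<bullet> \<alpha> = 0"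
      using that orth by blast
    then have "reflection \<alpha> \<beta> \<in> span A \<or> reflection \<alpha> \<beta> \<in> span B"
    proof (elim disjE conjE)
      assume "\<beta> \<bullet> \<alpha> = 0"
      then have "reflection \<alpha> \<beta> = \<beta>" by (rule reflection_orthogonal)
      then show ?thesis using that by simp
    qed (blast intro: reflection_in_span)+
    ultimately show ?thesis by blast
  qed
  have "root_system ?\<Psi>"
    unfolding root_system_def
  proof (intro conjI ballI allI impI)
    show "finite ?\<Psi>" "0 \<notin> ?\<Psi>" using assms(1) unfolding root_system_def by auto
    fix \<alpha> assume \<alpha>: "\<alpha> \<in> ?\<Psi>"
    show "c = 1 \<or> c = - 1" if "c *\<^sub>R \<alpha> \<in> ?\<Psi>" for c
    proof -
      have "\<forall>\<alpha>\<in>\<Phi>. \<forall>c::real. c *\<^sub>R \<alpha> \<in> \<Phi> \<longrightarrow> c = 1 \<or> c = - 1"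
        using assms(1) by (simp add: root_system_def)
      moreover have "\<alpha> \<in> \<Phi>" "c *\<^sub>R \<alpha> \<in> \<Phi>" using \<alpha> that by simp_all
      ultimately show ?thesis by blast
    qed
    fix \<beta> assume \<beta>: "\<beta> \<in> ?\<Psi>"
    show "reflection \<alpha> \<beta> \<in> ?\<Psi>" using \<alpha> \<beta> by (rule refl)
    show "cartan_number \<beta> \<alpha> \<in> \<int>" using assms(1) \<alpha> \<beta> unfolding root_system_def by simp
  qed
  moreover have "T \<subseteq> ?\<Psi>" using AB(4) assms(2) by (auto intro: span_base)
  ultimately have sub: "?H \<subseteq> ?\<Psi>"
    unfolding generated_subsystem_def by (intro hull_minimal) auto
  have T: "T \<subseteq> ?H" unfolding generated_subsystem_def by (rule hull_subset)
  have "\<not> irreducible_rs ?H"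
    unfolding irreducible_rs_def not_not
  proof (intro exI conjI)
    show "?H \<inter> span A \<noteq> {}" "?H \<inter> span B \<noteq> {}" using T AB by (auto dest: span_base)
    show "(?H \<inter> span A) \<inter> (?H \<inter> span B) = {}"
    proof (rule ccontr)
      assume "(?H \<inter> span A) \<inter> (?H \<inter> span B) \<noteq> {}"
      then obtain x where "x \<in> ?H" "x \<in> span A" "x \<in> span B" by blast
      then have "x \<in> \<Phi>" "x = 0" using sub orth[of x x] by auto
      then show False using assms(1) unfolding root_system_def by blast
    qed
    show "?H \<inter> span A \<union> ?H \<inter> span B = ?H" using sub by blast
    show "\<forall>\<alpha>\<in>?H \<inter> span A. \<forall>\<beta>\<in>?H \<inter> span B. \<alpha> \<bullet> \<beta> = 0" using orth by blast
  qed
  with assms(3) show False by blast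
qed

section \<open>Transport of simple systems and positive roots by reflections\<close>

lemma positive_roots_reflection_subset:
  assumes "\<beta> \<in> \<Phi>" "reflection \<alpha> \<beta> \<in> positive_roots \<Phi> D"
  shows "\<beta> \<in> positive_roots \<Phi> (reflection \<alpha> ` D)"
proof -
  let ?f = "reflection \<alpha>"
  obtain c where c: "?f \<beta> = (\<Sum>\<gamma>\<in>D. c \<gamma> *\<^sub>R \<gamma>)" "\<forall>\<gamma>\<in>D. 0 \<le> c \<gamma>"
    using assms(2) unfolding positive_roots_def by blast
  have "\<beta> = ?f (\<Sum>\<gamma>\<in>D. c \<gamma> *\<^sub>R \<gamma>)" by (simp add: reflection_reflection flip: c(1))
  \<comment> \<open>The coefficient is rewritten through the involution so that the sum can be
    reindexed along \<open>?f\<close>.\<close>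
  also have "\<dots> = (\<Sum>\<gamma>\<in>D. c (?f (?f \<gamma>)) *\<^sub>R ?f \<gamma>)"
    by (simp add: linear_sum[OF linear_reflection] linear_cmul[OF linear_reflection] reflection_reflection)
  also have "\<dots> = (\<Sum>\<delta>\<in>?f ` D. c (?f \<delta>) *\<^sub>R \<delta>)"
    by (subst sum.reindex, rule inj_on_inverseI[of _ ?f]) (simp_all add: reflection_reflection)
  finally show ?thesis
    unfolding positive_roots_def using assms(1) c(2)
    by (intro CollectI conjI exI[of _ "\<lambda>\<delta>. c (?f \<delta>)"]) (auto simp: reflection_reflection)
qed

lemma image_reflection_reflection: "reflection \<alpha> ` reflection \<alpha> ` D = D"
  by (simp add: image_image reflection_reflection)

lemma positive_roots_reflection:
  assumes "root_system \<Phi>" "\<alpha> \<in> \<Phi>"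
  shows "positive_roots \<Phi> (reflection \<alpha> ` D) = {\<beta>\<in>\<Phi>. reflection \<alpha> \<beta> \<in> positive_roots \<Phi> D}"
proof (intro equalityI subsetI)
  fix \<beta> assume b: "\<beta> \<in> positive_roots \<Phi> (reflection \<alpha> ` D)"
  then have "\<beta> \<in> \<Phi>" by (simp add: positive_roots_def)
  moreover have "reflection \<alpha> \<beta> \<in> \<Phi>" using assms \<open>\<beta> \<in> \<Phi>\<close> unfolding root_system_def by blast
  ultimately show "\<beta> \<in> {\<beta>\<in>\<Phi>. reflection \<alpha> \<beta> \<in> positive_roots \<Phi> D}"
    using positive_roots_reflection_subset[of "reflection \<alpha> \<beta>" \<Phi> \<alpha> "reflection \<alpha> ` D"] b
    by (simp add: reflection_reflection image_reflection_reflection)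
qed (use assms positive_roots_reflection_subset in blast)

lemma simple_system_reflection:
  assumes "root_system \<Phi>" "\<alpha> \<in> \<Phi>" "simple_system \<Phi> D"
  shows "simple_system \<Phi> (reflection \<alpha> ` D)"
  unfolding simple_system_def
proof (intro conjI ballI)
  let ?f = "reflection \<alpha>"
  have inj: "inj_on ?f X" for X
    by (rule inj_onI) (metis reflection_reflection)
  show "?f ` D \<subseteq> \<Phi>" using assms unfolding root_system_def simple_system_def by blast
  have "independent D" using assms(3) by (simp add: simple_system_def)
  then show "independent (?f ` D)"
    by (rule linear_independent_injective_image[OF linear_reflection]) (rule inj)
  fix \<beta> assume "\<beta> \<in> \<Phi>"
  then have "?f \<beta> \<in> \<Phi>" using assms unfolding root_system_def by blast
  then obtain c where c: "?f \<beta> = (\<Sum>\<gamma>\<in>D. c \<gamma> *\<^sub>R \<gamma>)" "(\<forall>\<gamma>\<in>D. 0 \<le> c \<gamma>) \<or> (\<forall>\<gamma>\<in>D. c \<gamma> \<le> 0)"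
    using assms(3) unfolding simple_system_def by blast
  have "\<beta> = ?f (\<Sum>\<gamma>\<in>D. c \<gamma> *\<^sub>R \<gamma>)" by (simp add: reflection_reflection flip: c(1))
  also have "\<dots> = (\<Sum>\<gamma>\<in>D. c (?f (?f \<gamma>)) *\<^sub>R ?f \<gamma>)"
    by (simp add: linear_sum[OF linear_reflection] linear_cmul[OF linear_reflection] reflection_reflection)
  also have "\<dots> = (\<Sum>\<delta>\<in>?f ` D. c (?f \<delta>) *\<^sub>R \<delta>)"
    by (subst sum.reindex[OF inj]) simp
  finally show "\<exists>c. \<beta> = (\<Sum>\<gamma>\<in>?f ` D. c \<gamma> *\<^sub>R \<gamma>) \<and>
      ((\<forall>\<beta>\<in>?f ` D. 0 \<le> c \<beta>) \<or> (\<forall>\<beta>\<in>?f ` D. c \<beta> \<le> 0))"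
    using c(2) by (intro exI[of _ "\<lambda>\<delta>. c (?f \<delta>)"]) (auto simp: reflection_reflection)
qed

section \<open>Recovering a simple system from its positive roots, and integrality\<close>

context based_root_system
begin

lemma pos_conj:
  assumes "\<beta> \<in> pos"
  obtains \<alpha> ws where "\<alpha> \<in> \<Delta>" "ws \<in> lists \<Delta>" "\<beta> = act ws \<alpha>"
proof -
  have "\<exists>\<alpha>\<in>\<Delta>. \<exists>ws\<in>lists \<Delta>. \<beta> = act ws \<alpha>"
    by (rule pos_conj_simple[OF assms subset_refl]) (rule coef_notin)
  then show thesis using that by blast
qed

lemma coef_sum_scaleR:
  assumes "D \<subseteq> span \<Delta>"
  shows "coef (\<Sum>\<delta>\<in>D. c \<delta> *\<^sub>R \<delta>) \<gamma> = (\<Sum>\<delta>\<in>D. c \<delta> * coef \<delta> \<gamma>)"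
  using assms
  by (subst representation_sum[OF indep])
    (auto simp: representation_scale[OF indep] span_scale subset_iff intro!: sum.cong)

text \<open>Simple roots are the indecomposable positive roots. In the expansion of \<alpha> over
  \<open>D\<close> all products of coefficients are nonnegative, so no cancellation is possible:
  each \<delta> that occurs is supported at \<alpha> alone and hence equals \<alpha>.\<close>

lemma simple_subset_if_pos_eq:
  assumes "simple_system \<Phi> D" "positive_roots \<Phi> D = pos"
  shows "\<Delta> \<subseteq> D"
proof
  interpret D: based_root_system \<Phi> D by unfold_locales (rule root_system, rule assms(1))
  fix \<alpha> assume a: "\<alpha> \<in> \<Delta>"
  then have "\<alpha> \<in> D.pos" using assms(2) simple_pos by simp
  then have nonneg: "\<And>\<delta>. 0 \<le> D.coef \<alpha> \<delta>" and \<alpha>: "\<alpha> \<in> span D"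
    using D.pos_iff D.root_span by blast+
  obtain \<delta> where \<delta>: "D.coef \<alpha> \<delta> \<noteq> 0"
    using D.coef_eq_0_imp[OF \<alpha>] simple_nonzero[OF a] by blast
  then have "\<delta> \<in> D" using D.coef_notin by blast
  have D_pos: "\<eta> \<in> pos" if "\<eta> \<in> D" for \<eta> using D.simple_pos[OF that] assms(2) by simp
  have "coef \<delta> \<gamma> = 0" if "\<gamma> \<noteq> \<alpha>" for \<gamma>
  proof -
    have "0 = coef (\<Sum>\<eta>\<in>D. D.coef \<alpha> \<eta> *\<^sub>R \<eta>) \<gamma>"
      using that a by (simp add: D.span_expansion[OF \<alpha>] coef_simple)
    also have "\<dots> = (\<Sum>\<eta>\<in>D. D.coef \<alpha> \<eta> * coef \<eta> \<gamma>)"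
      using D_pos by (intro coef_sum_scaleR) (auto intro: root_span pos_root)
    finally have "(\<Sum>\<eta>\<in>D. D.coef \<alpha> \<eta> * coef \<eta> \<gamma>) = 0" ..
    then have "\<forall>\<eta>\<in>D. D.coef \<alpha> \<eta> * coef \<eta> \<gamma> = 0"
      using D.finite_simple D_pos nonneg by (subst (asm) sum_nonneg_eq_0_iff) (auto simp: pos_iff)
    then show ?thesis using \<delta> \<open>\<delta> \<in> D\<close> by auto
  qed
  then have "\<delta> = \<alpha>" by (rule pos_multiple_of_simple[OF D_pos[OF \<open>\<delta> \<in> D\<close>] a])
  then show "\<alpha> \<in> D" using \<open>\<delta> \<in> D\<close> by simp
qed

text \<open>One inclusion holds because nonnegative combinations of positive roots have nonnegative
  coefficients. It forces the other, because both positive systems contain exactly one of each root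
  and its negative.\<close>

lemma pos_subset_if_simple_subset:
  assumes "simple_system \<Phi> D" "D \<subseteq> pos"
  shows "positive_roots \<Phi> D = pos"
proof -
  interpret D: based_root_system \<Phi> D by unfold_locales (rule root_system, rule assms(1))
  have *: "\<beta> \<in> pos" if b: "\<beta> \<in> D.pos" for \<beta>
  proof -
    have \<beta>: "\<beta> \<in> span D" using b D.pos_root D.root_span by blast
    have "0 \<le> coef \<beta> \<gamma>" for \<gamma>
    proof -
      have "coef (\<Sum>\<eta>\<in>D. D.coef \<beta> \<eta> *\<^sub>R \<eta>) \<gamma> = (\<Sum>\<eta>\<in>D. D.coef \<beta> \<eta> * coef \<eta> \<gamma>)"
        using assms(2) by (intro coef_sum_scaleR) (auto intro: root_span pos_root)
      then have "coef \<beta> \<gamma> = (\<Sum>\<eta>\<in>D. D.coef \<beta> \<eta> * coef \<eta> \<gamma>)"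
        by (simp add: D.span_expansion[OF \<beta>])
      also have "\<dots> \<ge> 0"
        using b assms(2) by (intro sum_nonneg mult_nonneg_nonneg) (auto simp: pos_iff D.pos_iff)
      finally show ?thesis .
    qed
    then show ?thesis using b by (simp add: pos_iff D.pos_iff)
  qed
  moreover have "\<beta> \<in> D.pos" if "\<beta> \<in> pos" for \<beta>
    using D.pos_or_neg[OF pos_root[OF that]] * not_pos_and_neg[OF that] by blast
  ultimately show ?thesis by blast
qed

text \<open>Every positive root is conjugate to a simple one by simple reflections, hence lies in
  each subsystem containing \<Delta>. This makes \<open>irreducible_generating_set\<close>
  applicable before any simple root has been deleted.\<close>

lemma generated_subsystem_simple: "generated_subsystem \<Phi> \<Delta> = \<Phi>"
proof
  show "generated_subsystem \<Phi> \<Delta> \<subseteq> \<Phi>"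
    unfolding generated_subsystem_def
    by (rule hull_minimal) (auto simp: simple_root root_system)
  show "\<Phi> \<subseteq> generated_subsystem \<Phi> \<Delta>"
    unfolding generated_subsystem_def hull_def
  proof (intro subsetI InterI, elim CollectE conjE)
    fix \<beta> \<Psi> assume b: "\<beta> \<in> \<Phi>" and \<Psi>: "root_system \<Psi>" "\<Delta> \<subseteq> \<Psi>"
    have refl: "reflection \<alpha> x \<in> \<Psi>" if "\<alpha> \<in> \<Psi>" "x \<in> \<Psi>" for \<alpha> x
      using \<Psi>(1) that unfolding root_system_def by blast
    have act: "act ws x \<in> \<Psi>" if "ws \<in> lists \<Delta>" "x \<in> \<Psi>" for ws x
      using that \<Psi>(2) by (induction ws) (auto intro!: refl)
    have pos: "\<gamma> \<in> \<Psi>" if "\<gamma> \<in> pos" for \<gamma>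
    proof -
      obtain \<alpha> ws where "\<alpha> \<in> \<Delta>" "ws \<in> lists \<Delta>" "\<gamma> = act ws \<alpha>"
        by (rule pos_conj[OF \<open>\<gamma> \<in> pos\<close>])
      then show ?thesis using act \<Psi>(2) by blast
    qed
    from pos_or_neg[OF b] show "\<beta> \<in> \<Psi>"
    proof
      assume "- \<beta> \<in> pos"
      then have "- \<beta> \<in> \<Psi>" by (rule pos)
      moreover have "- \<beta> \<noteq> 0" using b zero_notin_roots by auto
      ultimately show ?thesis using refl[of "- \<beta>" "- \<beta>"] by (simp add: reflection_self)
    qed (rule pos)
  qed
qed

lemma irreducible_simple: "irreducible_rs \<Phi> \<Longrightarrow> irreducible_rs \<Delta>"
  by (rule irreducible_generating_set[OF root_system simple_subset])
    (simp add: generated_subsystem_simple)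

text \<open>The second number is the coefficient of the coroot 2\<beta> / (\<beta> \<bullet>
  \<beta>) at the simple coroot of \<gamma>. Along a word in simple reflections each of the two
  numbers changes only at the reflecting root, by one of the two Cartan numbers of the pair. The
  coroot version is needed for the long simple root in type C.\<close>

lemma coef_integral:
  assumes "\<beta> \<in> pos"
  shows "coef \<beta> \<gamma> \<in> \<int>" "coef \<beta> \<gamma> * (\<gamma> \<bullet> \<gamma>) / (\<beta> \<bullet> \<beta>) \<in> \<int>"
proof -
  have "coef v \<gamma> \<in> \<int> \<and> coef v \<gamma> * (\<gamma> \<bullet> \<gamma>) / (v \<bullet> v) \<in> \<int>"
    if "ws \<in> lists \<Delta>" "\<alpha> \<in> \<Delta>" "v = act ws \<alpha>" for ws \<alpha> v
    using that
  proof (induction ws arbitrary: v)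
    case Nil
    then show ?case using simple_nonzero by (simp add: coef_simple)
  next
    case (Cons \<delta> ws)
    define u where "u = act ws \<alpha>"
    have \<delta>: "\<delta> \<in> \<Delta>" and ws: "set ws \<subseteq> \<Delta>" using Cons.hyps by (auto simp: in_lists_conv_set)
    have u: "u \<in> \<Phi>" unfolding u_def using Cons.prems ws by (intro act_root simple_root)
    have v: "v = reflection \<delta> u" using Cons.prems by (simp add: u_def)
    have IH: "coef u \<gamma> \<in> \<int>" "coef u \<gamma> * (\<gamma> \<bullet> \<gamma>) / (u \<bullet> u) \<in> \<int>"
      using Cons.IH[OF Cons.prems(1) u_def] by blast+
    show ?case
    proof (cases "\<gamma> = \<delta>")
      case False
      then have "coef v \<gamma> = coef u \<gamma>" unfolding v using \<delta> by (simp add: coef_reflection root_span u)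
      then show ?thesis using IH by (simp add: v inner_reflection)
    next
      case True
      have c: "coef v \<gamma> = coef u \<gamma> - cartan_number u \<delta>"
        unfolding v using True \<delta> by (simp add: coef_reflection root_span u)
      have "coef v \<gamma> * (\<gamma> \<bullet> \<gamma>) = coef u \<gamma> * (\<gamma> \<bullet> \<gamma>) - 2 * (\<delta> \<bullet> u)"
        using cartan_number_mult[of u \<delta>] unfolding c by (simp add: True left_diff_distrib inner_commute)
      then have "coef v \<gamma> * (\<gamma> \<bullet> \<gamma>) / (v \<bullet> v) = coef u \<gamma> * (\<gamma> \<bullet> \<gamma>) / (u \<bullet> u) - cartan_number \<delta> u"
        by (simp add: v inner_reflection cartan_number_def diff_divide_distrib)
      moreover have "cartan_number u \<delta> \<in> \<int>" "cartan_number \<delta> u \<in> \<int>"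
        using u \<delta> by (simp_all add: cartan_number_int simple_root)
      ultimately show ?thesis using IH c by simp
    qed
  qed
  moreover obtain \<alpha> ws where "\<alpha> \<in> \<Delta>" "ws \<in> lists \<Delta>" "\<beta> = act ws \<alpha>"
    by (rule pos_conj[OF assms])
  ultimately show "coef \<beta> \<gamma> \<in> \<int>" "coef \<beta> \<gamma> * (\<gamma> \<bullet> \<gamma>) / (\<beta> \<bullet> \<beta>) \<in> \<int>" by blast+
qed

end

text \<open>The induction is on the number of roots that are positive for \<Delta> but not for
  \<open>D\<close>. Reflecting \<Delta> in a simple root of this kind permutes the other positive
  roots and removes that root from the count.\<close>

lemma simple_system_conj:
  assumes "root_system \<Phi>" "simple_system \<Phi> \<Delta>" "simple_system \<Phi> D"
  shows "\<exists>ws. D = act ws ` \<Delta>"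
  using assms(2)
proof (induction "card (positive_roots \<Phi> \<Delta> - positive_roots \<Phi> D)" arbitrary: \<Delta> rule: less_induct)
  case less
  interpret based_root_system \<Phi> \<Delta> by unfold_locales (rule assms(1), rule less.prems)
  interpret D: based_root_system \<Phi> D by unfold_locales (rule assms(1), rule assms(3))
  show ?case
  proof (cases "\<Delta> \<subseteq> D.pos")
    case True
    then have "pos = D.pos" by (rule D.pos_subset_if_simple_subset[OF less.prems])
    then have "\<Delta> = D"
      using simple_subset_if_pos_eq[OF assms(3)] D.simple_subset_if_pos_eq[OF less.prems] by blast
    then have "D = act [] ` \<Delta>" by simp
    then show ?thesis ..
  next
    case False
    then obtain \<alpha> where a: "\<alpha> \<in> \<Delta>" "\<alpha> \<notin> D.pos" by blast
    then have "- \<alpha> \<in> D.pos" using D.pos_or_neg simple_root by blast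
    let ?\<Delta> = "reflection \<alpha> ` \<Delta>"
    let ?P = "positive_roots \<Phi> ?\<Delta>"
    have P: "?P = {\<beta>\<in>\<Phi>. reflection \<alpha> \<beta> \<in> pos}"
      by (rule positive_roots_reflection[OF assms(1) simple_root[OF a(1)]])
    have neg: "reflection \<alpha> \<alpha> = - \<alpha>" using a simple_nonzero by (simp add: reflection_self)
    have "?P - D.pos \<subset> pos - D.pos"
    proof
      show "?P - D.pos \<subseteq> pos - D.pos"
      proof
        fix \<beta> assume b: "\<beta> \<in> ?P - D.pos"
        \<comment> \<open>Otherwise \<beta> would be -\<alpha>, which is positive for
          \<open>D\<close>.\<close>
        have "reflection \<alpha> \<beta> \<noteq> \<alpha>"
          using b \<open>- \<alpha> \<in> D.pos\<close> neg reflection_reflection[of \<alpha> \<beta>] by auto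
        moreover have "reflection \<alpha> \<beta> \<in> pos" using b P by blast
        ultimately have "reflection \<alpha> (reflection \<alpha> \<beta>) \<in> pos" using a(1) reflection_pos by blast
        then show "\<beta> \<in> pos - D.pos" using b by (simp add: reflection_reflection)
      qed
      have "\<alpha> \<in> pos" using a by (simp add: simple_pos)
      then have "\<alpha> \<notin> ?P" using not_pos_and_neg by (simp add: P neg)
      with \<open>\<alpha> \<in> pos\<close> a show "?P - D.pos \<noteq> pos - D.pos" by blast
    qed
    moreover have "finite (pos - D.pos)"
      by (rule finite_subset[OF _ finite_roots]) (auto simp: pos_iff)
    ultimately have "card (?P - D.pos) < card (pos - D.pos)" by (rule psubset_card_mono[rotated])
    then obtain ws where "D = act ws ` ?\<Delta>"
      using less.hyps simple_system_reflection[OF assms(1) simple_root[OF a(1)] less.prems] by blast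
    then have "D = act (ws @ [\<alpha>]) ` \<Delta>" by (simp add: image_image)
    then show ?thesis ..
  qed
qed

subsection \<open>Coefficients of roots in the classical types\<close>

text \<open>This turns a value of the quadratic form, a sum of integer squares, into linear bounds
  on the coefficients.\<close>

lemma Ints_le_power2:
  fixes z :: real
  assumes "z \<in> \<int>"
  shows "z \<le> z\<^sup>2" "- z \<le> z\<^sup>2"
proof -
  obtain k where k: "z = of_int k" using assms by (rule Ints_cases)
  have "\<bar>k\<bar> \<le> \<bar>k\<bar>\<^sup>2"
  proof (cases "k = 0")
    case False
    then show ?thesis by (intro self_le_power) linarith+
  qed simp
  then have "k \<le> k\<^sup>2" "- k \<le> k\<^sup>2" unfolding power2_abs by linarith+
  then have "real_of_int k \<le> real_of_int (k\<^sup>2)" "real_of_int (- k) \<le> real_of_int (k\<^sup>2)"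
    by (simp_all only: of_int_le_iff)
  then show "z \<le> z\<^sup>2" "- z \<le> z\<^sup>2" by (simp_all only: k of_int_power of_int_minus)
qed

lemma Ints_le_1_if_power2_le_2:
  fixes z :: real
  assumes "z \<in> \<int>" "z\<^sup>2 \<le> 2"
  shows "z \<le> 1"
proof (rule ccontr)
  obtain k where k: "z = of_int k" using assms(1) by (rule Ints_cases)
  assume "\<not> z \<le> 1"
  then have "2 \<le> z" unfolding k by simp
  then have "2 * 2 \<le> z * z" by (intro mult_mono) linarith+
  with assms(2) show False unfolding power2_eq_square by linarith
qed

text \<open>The increments telescope to \<open>c m\<close>, and each is at most its square.\<close>

lemma le_sum_increments_power2:
  fixes c :: "nat \<Rightarrow> real"
  assumes "c 0 = 0" "\<And>i. c i \<in> \<int>"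
  shows "c m \<le> (\<Sum>i=1..m. (c i - c (i - 1))\<^sup>2)"
proof (induction m)
  case (Suc m)
  have "c (Suc m) - c m \<le> (c (Suc m) - c m)\<^sup>2"
    by (rule Ints_le_power2(1)[OF Ints_diff[OF assms(2) assms(2)]])
  with Suc show ?case by simp
qed (simp add: assms(1))

text \<open>The left side is the rise from 0 to \<open>c k\<close> plus the drop from
  \<open>c k\<close> to \<open>c m\<close>; each is bounded by the squares of its own
  increments.\<close>

lemma double_le_sum_increments_power2:
  fixes c :: "nat \<Rightarrow> real"
  assumes "c 0 = 0" "\<And>i. c i \<in> \<int>" "k \<le> m"
  shows "2 * c k - c m \<le> (\<Sum>i=1..m. (c i - c (i - 1))\<^sup>2)"
  using assms(3)
proof (induction m)
  case 0
  then show ?case using assms(1) by simp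
next
  case (Suc m)
  show ?case
  proof (cases "k = Suc m")
    case True
    show ?thesis unfolding True using le_sum_increments_power2[of c "Suc m", OF assms(1,2)] by linarith
  next
    case False
    have "- (c (Suc m) - c m) \<le> (c (Suc m) - c m)\<^sup>2"
      by (rule Ints_le_power2(2)[OF Ints_diff[OF assms(2) assms(2)]])
    with Suc False show ?thesis by simp
  qed
qed

lemma increment_power2_le_sum:
  fixes c :: "nat \<Rightarrow> real"
  assumes "1 \<le> k" "k \<le> m"
  shows "(c k - c (k - 1))\<^sup>2 \<le> (\<Sum>i=1..m. (c i - c (i - 1))\<^sup>2)"
  by (rule member_le_sum[where f = "\<lambda>i. (c i - c (i - 1))\<^sup>2"]) (use assms in auto)

section \<open>The quadratic form on chains of simple roots\<close>

lemma inner_chain_sum: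
  fixes a :: "nat \<Rightarrow> 'a::real_inner"
  assumes "c 0 = 0" "\<And>i. 1 \<le> i \<Longrightarrow> i \<le> m \<Longrightarrow> a i \<bullet> y = (if i = m then K else 0)"
  shows "(\<Sum>i=1..m. c i *\<^sub>R a i) \<bullet> y = c m * K"
proof (cases m)
  case 0
  then show ?thesis by (simp add: assms(1))
next
  case (Suc l)
  have "(\<Sum>i=1..m. c i *\<^sub>R a i) \<bullet> y = (\<Sum>i=1..m. if i = m then c m * K else 0)"
    unfolding inner_sum_left by (rule sum.cong) (auto simp: assms(2))
  then show ?thesis using Suc by simp
qed

text \<open>The vectors behave like multiples of e_i - e_(i+1) in type A. The term
  \<open>(c m)\<^sup>2\<close> is the square of the coordinate at e_(m+1), which the later
  computations complete to a square involving the next node.\<close>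

lemma norm_chain_sum:
  fixes a :: "nat \<Rightarrow> 'a::real_inner"
  assumes "c 0 = 0" "\<And>i. 1 \<le> i \<Longrightarrow> i \<le> m \<Longrightarrow> a i \<bullet> a i = L"
    and "\<And>i j. 1 \<le> i \<Longrightarrow> i < j \<Longrightarrow> j \<le> m \<Longrightarrow> a i \<bullet> a j = (if j = Suc i then - L / 2 else 0)"
  shows "2 * ((\<Sum>i=1..m. c i *\<^sub>R a i) \<bullet> (\<Sum>i=1..m. c i *\<^sub>R a i)) =
    L * ((\<Sum>i=1..m. (c i - c (i - 1))\<^sup>2) + (c m)\<^sup>2)"
  using assms(2,3)
proof (induction m)
  case (Suc m)
  let ?v = "\<Sum>i=1..m. c i *\<^sub>R a i"
  have IH: "2 * (?v \<bullet> ?v) = L * ((\<Sum>i=1..m. (c i - c (i - 1))\<^sup>2) + (c m)\<^sup>2)"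
    by (rule Suc.IH) (use Suc.prems in auto)
  have v: "?v \<bullet> a (Suc m) = c m * (- L / 2)"
    by (rule inner_chain_sum[where c = c, OF assms(1)]) (use Suc.prems(2)[of _ "Suc m"] in auto)
  have a: "a (Suc m) \<bullet> a (Suc m) = L" using Suc.prems(1) by simp
  have "2 * ((?v + c (Suc m) *\<^sub>R a (Suc m)) \<bullet> (?v + c (Suc m) *\<^sub>R a (Suc m))) =
    2 * (?v \<bullet> ?v) + 4 * c (Suc m) * (?v \<bullet> a (Suc m)) + 2 * (c (Suc m))\<^sup>2 * (a (Suc m) \<bullet> a (Suc m))"
    by (simp add: inner_add_left inner_add_right inner_commute power2_eq_square)
  also have "\<dots> = L * ((\<Sum>i=1..m. (c i - c (i - 1))\<^sup>2) + (c m)\<^sup>2) - 2 * c (Suc m) * c m * L + 2 * (c (Suc m))\<^sup>2 * L"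
    unfolding IH v a by simp
  also have "\<dots> = L * ((\<Sum>i=1..m. (c i - c (i - 1))\<^sup>2) + (c (Suc m) - c m)\<^sup>2 + (c (Suc m))\<^sup>2)"
    by (simp add: algebra_simps power2_eq_square)
  finally show ?case by simp
qed (simp add: assms)

lemma norm_add_scaleR:
  fixes v :: "'a::real_inner"
  shows "2 * ((v + s *\<^sub>R y) \<bullet> (v + s *\<^sub>R y)) = 2 * (v \<bullet> v) + 4 * s * (v \<bullet> y) + 2 * s\<^sup>2 * (y \<bullet> y)"
  by (simp add: inner_add_left inner_add_right inner_commute power2_eq_square)

lemma path_equal_lengths:
  fixes a :: "nat \<Rightarrow> 'a::real_inner"
  assumes "\<And>i. 1 \<le> i \<Longrightarrow> i < m \<Longrightarrow> a i \<bullet> a i = a (Suc i) \<bullet> a (Suc i)" "1 \<le> i" "i \<le> m"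
  shows "a i \<bullet> a i = a 1 \<bullet> a 1"
  using assms(2,3)
proof (induction i rule: dec_induct)
  case (step i)
  then show ?case using assms(1)[of i] by simp
qed simp

text \<open>With \<open>c\<^sub>i\<close> the coefficient at \<open>\<alpha>\<^sub>i\<close>, the bracketed squares below are the squared
  coordinates of the vector in the usual orthogonal realization of the classical root systems.\<close>

locale classical_base =
  fixes X :: classical_type and n :: nat and a :: "nat \<Rightarrow> 'a::euclidean_space"
  assumes rank: "min_rank X \<le> n"
    and cartan: "\<And>i j. i \<in> {1..n} \<Longrightarrow> j \<in> {1..n} \<Longrightarrow>
      cartan_number (a i) (a j) = of_int (cartan_matrix X n i j)"
    and nonzero: "\<And>i. i \<in> {1..n} \<Longrightarrow> a i \<noteq> 0"
    and inj: "inj_on a {1..n}"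
begin

text \<open>The squared length shared by all nodes except possibly the last, used as the unit of
  length.\<close>

definition L :: real where "L = a 1 \<bullet> a 1"

lemma rank_pos: "1 \<le> n"
  using rank by (cases X) auto

lemma L_pos: "0 < L"
  using nonzero[of 1] rank_pos by (simp add: L_def)

lemma inner_base: "i \<in> {1..n} \<Longrightarrow> j \<in> {1..n} \<Longrightarrow>
    2 * (a i \<bullet> a j) = of_int (cartan_matrix X n i j) * (a j \<bullet> a j)"
  using cartan_number_mult[of "a i" "a j"] cartan by simp

lemma inner_base_eq_0_iff: "i \<in> {1..n} \<Longrightarrow> j \<in> {1..n} \<Longrightarrow>
    a i \<bullet> a j = 0 \<longleftrightarrow> cartan_matrix X n i j = 0"
  using inner_base[of i j] nonzero by auto

text \<open>Cartan entries -1 in both directions equate the lengths along the path. The last node is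
  compared with the node to which it is attached, where the ratio of the two opposite entries gives
  the ratio of squared lengths.\<close>

lemma base_lengths:
  assumes "i \<in> {1..n}"
  shows "a i \<bullet> a i = (if i = n then (case X of type_B \<Rightarrow> L / 2 | type_C \<Rightarrow> 2 * L | _ \<Rightarrow> L) else L)"
proof -
  have path: "a i \<bullet> a i = L" if "1 \<le> i" "i \<le> n" "i \<noteq> n \<or> X = type_A" for i
    unfolding L_def
  proof (rule path_equal_lengths[where m = "if X = type_A then n else n - 1"])
    fix i assume "1 \<le> i" "i < (if X = type_A then n else n - 1)"
    then have "Suc i \<le> n" "X = type_A \<or> Suc i < n" "1 \<le> i" by (auto split: if_splits)
    then have "cartan_matrix X n i (Suc i) = -1" "cartan_matrix X n (Suc i) i = -1"
      by (cases X; auto simp: path_matrix_def doubleton_eq_iff)+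
    then show "a i \<bullet> a i = a (Suc i) \<bullet> a (Suc i)"
      using inner_base[of i "Suc i"] inner_base[of "Suc i" i] \<open>Suc i \<le> n\<close> \<open>1 \<le> i\<close>
      by (simp add: inner_commute)
  qed (use that in auto)
  show ?thesis
  proof (cases "i = n \<and> X \<noteq> type_A")
    case False
    then show ?thesis using path[of i] assms by (auto split: classical_type.split)
  next
    case True
    \<comment> \<open>The node adjacent to node \<open>n\<close>: in type D it is the fork,
      otherwise the predecessor.\<close>
    define l where "l = (if X = type_D then n - 2 else n - 1)"
    have l: "1 \<le> l" "l < n" using True rank unfolding l_def by (cases X; auto)+
    have "of_int (cartan_matrix X n n l) * (a l \<bullet> a l) = (of_int (cartan_matrix X n l n) * (a n \<bullet> a n) :: real)"
      using inner_base[of l n] inner_base[of n l] l by (simp add: inner_commute)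
    moreover have "a l \<bullet> a l = L" using path l by simp
    ultimately show ?thesis
      using True l rank_pos by (cases X) (auto simp: l_def path_matrix_def doubleton_eq_iff split: if_splits)
  qed
qed

lemma path_inner:
  assumes "1 \<le> i" "i < j" "j \<le> n" "j < n \<or> X = type_A"
  shows "a i \<bullet> a j = (if j = Suc i then - L / 2 else 0)"
proof -
  have "cartan_matrix X n i j = (if j = Suc i then -1 else 0)"
    using assms by (cases X) (auto simp: path_matrix_def doubleton_eq_iff)
  moreover have "a j \<bullet> a j = L" using assms base_lengths[of j] by (cases X) auto
  ultimately show ?thesis using inner_base[of i j] assms by (simp split: if_splits)
qed

lemma norm_path:
  assumes "c 0 = 0" "m < n \<or> m = n \<and> X = type_A"
  shows "2 * ((\<Sum>i=1..m. c i *\<^sub>R a i) \<bullet> (\<Sum>i=1..m. c i *\<^sub>R a i)) =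
    L * ((\<Sum>i=1..m. (c i - c (i - 1))\<^sup>2) + (c m)\<^sup>2)"
proof (rule norm_chain_sum[where L = L and c = c, OF assms(1)])
  show "a i \<bullet> a i = L" if "1 \<le> i" "i \<le> m" for i
    using base_lengths[of i] that assms(2) by (cases X) auto
qed (rule path_inner; use assms(2) in auto)

text \<open>Here the last simple root is e_n, so no further coordinate appears: the leftover
  \<open>(c m)\<^sup>2\<close> of \<open>norm_path\<close> is completed to the square of c_n -
  c_m.\<close>

lemma norm_B:
  assumes "X = type_B" "c 0 = 0"
  shows "2 * ((\<Sum>i=1..n. c i *\<^sub>R a i) \<bullet> (\<Sum>i=1..n. c i *\<^sub>R a i)) =
    L * (\<Sum>i=1..n. (c i - c (i - 1))\<^sup>2)"
proof -
  obtain m where n: "n = Suc m" "1 \<le> m" using rank assms(1) by (cases n) auto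
  let ?v = "\<Sum>i=1..m. c i *\<^sub>R a i"
  have an: "a n \<bullet> a n = L / 2" using base_lengths[of n] rank_pos assms(1) by simp
  have "?v \<bullet> a n = c m * (- L / 2)"
  proof (rule inner_chain_sum[where c = c, OF assms(2)])
    fix i assume "1 \<le> i" "i \<le> m"
    then show "a i \<bullet> a n = (if i = m then - L / 2 else 0)"
      using inner_base[of i n] n an assms(1) by (auto simp: path_matrix_def)
  qed
  moreover have "2 * (?v \<bullet> ?v) = L * ((\<Sum>i=1..m. (c i - c (i - 1))\<^sup>2) + (c m)\<^sup>2)"
    by (rule norm_path[where c = c, OF assms(2)]) (simp add: n)
  ultimately have "2 * ((?v + c n *\<^sub>R a n) \<bullet> (?v + c n *\<^sub>R a n)) =
      L * ((\<Sum>i=1..m. (c i - c (i - 1))\<^sup>2) + (c n - c m)\<^sup>2)"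
    unfolding norm_add_scaleR by (simp add: an power2_eq_square algebra_simps)
  then show ?thesis by (simp add: n)
qed

text \<open>The last simple root is 2 e_n, whence the factor 2 at \<open>c n\<close> in the last
  coordinate.\<close>

lemma norm_C:
  assumes "X = type_C" "c 0 = 0"
  shows "2 * ((\<Sum>i=1..n. c i *\<^sub>R a i) \<bullet> (\<Sum>i=1..n. c i *\<^sub>R a i)) =
    L * ((\<Sum>i=1..n-1. (c i - c (i - 1))\<^sup>2) + (c (n - 1) - 2 * c n)\<^sup>2)"
proof -
  obtain m where n: "n = Suc m" "1 \<le> m" using rank assms(1) by (cases n) auto
  let ?v = "\<Sum>i=1..m. c i *\<^sub>R a i"
  have an: "a n \<bullet> a n = 2 * L" using base_lengths[of n] rank_pos assms(1) by simp
  have "?v \<bullet> a n = c m * (- L)"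
  proof (rule inner_chain_sum[where c = c, OF assms(2)])
    fix i assume "1 \<le> i" "i \<le> m"
    then show "a i \<bullet> a n = (if i = m then - L else 0)"
      using inner_base[of i n] n an assms(1) by (auto simp: path_matrix_def)
  qed
  moreover have "2 * (?v \<bullet> ?v) = L * ((\<Sum>i=1..m. (c i - c (i - 1))\<^sup>2) + (c m)\<^sup>2)"
    by (rule norm_path[where c = c, OF assms(2)]) (simp add: n)
  ultimately have "2 * ((?v + c n *\<^sub>R a n) \<bullet> (?v + c n *\<^sub>R a n)) =
      L * ((\<Sum>i=1..m. (c i - c (i - 1))\<^sup>2) + (c m - 2 * c n)\<^sup>2)"
    unfolding norm_add_scaleR by (simp add: an power2_eq_square algebra_simps)
  then show ?thesis by (simp add: n)
qed

text \<open>The last two simple roots are e_(n-1) - e_n and e_(n-1) + e_n; the two final squares are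
  their joint contribution to the coordinates \<open>n - 1\<close> and \<open>n\<close>.\<close>

lemma norm_D:
  assumes "X = type_D" "c 0 = 0"
  shows "2 * ((\<Sum>i=1..n. c i *\<^sub>R a i) \<bullet> (\<Sum>i=1..n. c i *\<^sub>R a i)) =
    L * ((\<Sum>i=1..n-2. (c i - c (i - 1))\<^sup>2) + (c (n - 1) + c n - c (n - 2))\<^sup>2 + (c n - c (n - 1))\<^sup>2)"
proof -
  obtain m where n: "n = Suc (Suc m)" "2 \<le> m"
    using rank assms(1) that[of "n - 2"] by simp
  let ?v = "\<Sum>i=1..m. c i *\<^sub>R a i" and ?p = "Suc m"
  let ?w = "?v + c ?p *\<^sub>R a ?p"
  have lengths: "a n \<bullet> a n = L" "a ?p \<bullet> a ?p = L"
    using base_lengths[of n] base_lengths[of ?p] rank_pos assms(1) n by simp_all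
  have v: "?v \<bullet> a j = c m * (- L / 2)" if "j = n \<or> j = ?p" for j
  proof (rule inner_chain_sum[where c = c, OF assms(2)])
    fix i assume "1 \<le> i" "i \<le> m"
    then show "a i \<bullet> a j = (if i = m then - L / 2 else 0)"
      using inner_base[of i j] n lengths assms(1) that by (auto simp: path_matrix_def doubleton_eq_iff)
  qed
  have vp: "?v \<bullet> a ?p = c m * (- L / 2)" by (rule v) simp
  have "a ?p \<bullet> a n = 0" using inner_base[of ?p n] n assms(1) by simp
  then have w: "?w \<bullet> a n = c m * (- L / 2)" using v[of n] by (simp add: inner_add_left)
  have "2 * (?v \<bullet> ?v) = L * ((\<Sum>i=1..m. (c i - c (i - 1))\<^sup>2) + (c m)\<^sup>2)"
    by (rule norm_path[where c = c, OF assms(2)]) (simp add: n)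
  then have "2 * (?w \<bullet> ?w) = L * ((\<Sum>i=1..m. (c i - c (i - 1))\<^sup>2) + (c m)\<^sup>2 - 2 * c ?p * c m + 2 * (c ?p)\<^sup>2)"
    unfolding norm_add_scaleR vp by (simp add: lengths algebra_simps)
  then have "2 * ((?w + c n *\<^sub>R a n) \<bullet> (?w + c n *\<^sub>R a n)) =
      L * ((\<Sum>i=1..m. (c i - c (i - 1))\<^sup>2) + (c ?p + c n - c m)\<^sup>2 + (c n - c ?p)\<^sup>2)"
    unfolding norm_add_scaleR[of ?w] w by (simp add: lengths power2_eq_square algebra_simps)
  then show ?thesis by (simp add: n)
qed

section \<open>Leaves of subdiagrams in the classical types\<close>

text \<open>A version of \<open>irreducible_cut\<close> on indices: if deleting node
  \<open>k\<close> separates two remaining nodes of \<open>S\<close>, then \<open>S - {a k}\<close>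
  is not connected. Injectivity of \<open>a\<close> lets the predicate on indices pass to
  vectors.\<close>

lemma cut_contradiction:
  assumes "irreducible_rs (S - {a k})" "S \<subseteq> a ` {1..n}" "k \<in> {1..n}"
    and uv: "u \<in> {1..n} - {k}" "v \<in> {1..n} - {k}" "a u \<in> S" "a v \<in> S" "Q u" "\<not> Q v"
    and orth: "\<And>p q. p \<in> {1..n} - {k} \<Longrightarrow> q \<in> {1..n} - {k} \<Longrightarrow> Q p \<Longrightarrow> \<not> Q q \<Longrightarrow> a p \<bullet> a q = 0"
  shows False
proof -
  have neq: "a p \<noteq> a k" if "p \<in> {1..n} - {k}" for p
    using inj_on_eq_iff[OF inj, of p k] that assms(3) by blast
  let ?Q = "\<lambda>x. \<exists>p\<in>{1..n}. a p = x \<and> Q p"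
  have "\<not> ?Q (a v)" using uv(2,6) inj_on_eq_iff[OF inj] by blast
  moreover have "?Q (a u)" using uv by blast
  moreover have "a u \<in> S - {a k}" "a v \<in> S - {a k}" using uv neq by blast+
  ultimately obtain x y where xy: "x \<in> S - {a k}" "y \<in> S - {a k}" "?Q x" "\<not> ?Q y" "x \<bullet> y \<noteq> 0"
    using irreducible_cut[OF assms(1), of "a u" "a v" ?Q] by blast
  obtain p where p: "p \<in> {1..n}" "x = a p" "Q p" using xy by blast
  obtain q where q: "q \<in> {1..n}" "y = a q" using xy assms(2) by blast
  have "p \<noteq> k" "q \<noteq> k" "\<not> Q q" using xy p q by auto
  then show False using orth[of p q] p q xy by auto
qed

text \<open>Node \<open>k\<close> cuts the diagram into lower and higher indices. In type D this
  fails at \<open>k = n - 1\<close>, where the nodes \<open>n - 2\<close> and \<open>n\<close> are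
  joined across \<open>k\<close>.\<close>

lemma inner_across:
  assumes "1 \<le> p" "p < k" "k < q" "q \<le> n" "X = type_D \<Longrightarrow> k \<le> n - 2"
  shows "a p \<bullet> a q = 0"
proof -
  have "cartan_matrix X n p q = 0"
    using assms by (cases X) (auto simp: path_matrix_def doubleton_eq_iff)
  then show ?thesis using inner_base_eq_0_iff[of p q] assms by simp
qed

lemma not_both_sides:
  assumes "irreducible_rs (S - {a k})" "S \<subseteq> a ` {1..n}" "X = type_D \<Longrightarrow> k \<le> n - 2"
    and "1 \<le> u" "u < k" "k < v" "v \<le> n" "a u \<in> S" "a v \<in> S"
  shows False
proof (rule cut_contradiction[OF assms(1,2), where u = u and v = v and Q = "\<lambda>p. p < k"])
  fix p q assume "p \<in> {1..n} - {k}" "q \<in> {1..n} - {k}" "p < k" "\<not> q < k"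
  then show "a p \<bullet> a q = 0" by (intro inner_across[of p k q] assms(3)) simp_all
qed (use assms(4-) in simp_all)

text \<open>Off type D the neighbours of \<open>k\<close> have index k - 1 or k + 1, so two of them
  lie on opposite sides, against \<open>not_both_sides\<close>. In type D only the fork
  \<open>k = n - 2\<close> remains, with node \<open>n\<close> as one of the two neighbours.\<close>

lemma unique_neighbour:
  assumes irr: "irreducible_rs (S - {a k})" "S \<subseteq> a ` {1..n}" and k: "k \<in> {1..n}"
    and u: "u \<in> {1..n} - {k}" "a u \<in> S" "a u \<bullet> a k \<noteq> 0"
    and v: "v \<in> {1..n} - {k}" "a v \<in> S" "a v \<bullet> a k \<noteq> 0"
  shows "u = v"
proof (rule ccontr)
  assume neq: "u \<noteq> v"
  have range: "1 \<le> u" "u \<le> n" "1 \<le> v" "v \<le> n" "1 \<le> k" "k \<le> n" "u \<noteq> k" "v \<noteq> k"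
    using u(1) v(1) k by simp_all
  have C: "cartan_matrix X n u k \<noteq> 0" "cartan_matrix X n v k \<noteq> 0"
    using inner_base_eq_0_iff[of u k] inner_base_eq_0_iff[of v k] u v k by simp_all
  have sides: False if "X = type_D \<Longrightarrow> k \<le> n - 2" "u < k \<and> k < v \<or> v < k \<and> k < u"
    using that(2)
  proof (elim disjE conjE)
    assume "u < k" "k < v"
    then show False using not_both_sides[OF irr that(1) range(1) _ _ range(4) u(2) v(2)] by simp
  next
    assume "v < k" "k < u"
    then show False using not_both_sides[OF irr that(1) range(3) _ _ range(2) v(2) u(2)] by simp
  qed
  have path: "p = k + 1 \<or> k = p + 1" if "X \<noteq> type_D" "p \<noteq> k" "cartan_matrix X n p k \<noteq> 0" for p
  proof (rule ccontr)
    assume *: "\<not> ?thesis"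
    then have "path_matrix p k = 0" using that(2) by (simp add: path_matrix_def)
    moreover have "\<not> (p = n - 1 \<and> k = n)" "\<not> (p = n \<and> k = n - 1)" using * range by linarith+
    ultimately show False using that(1,3) by (cases X) auto
  qed
  have D: "X = type_D"
  proof (rule ccontr)
    assume "X \<noteq> type_D"
    then have "u = k + 1 \<or> k = u + 1" "v = k + 1 \<or> k = v + 1" using path range C by blast+
    then have "u < k \<and> k < v \<or> v < k \<and> k < u" using neq by linarith
    with \<open>X \<noteq> type_D\<close> show False using sides by blast
  qed
  have n: "4 \<le> n" using rank D by simp
  have fork: "(p = k + 1 \<or> k = p + 1) \<and> {p, k} \<noteq> {n - 1, n} \<or> {p, k} = {n - 2, n}"
    if "p \<noteq> k" "cartan_matrix X n p k \<noteq> 0" for p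
  proof (rule ccontr)
    assume *: "\<not> ?thesis"
    have "cartan_matrix X n p k = (if {p, k} = {n - 1, n} then 0
        else if {p, k} = {n - 2, n} then - 1 else path_matrix p k)"
      unfolding D by (rule cartan_matrix.simps(4))
    then have "{p, k} \<noteq> {n - 1, n}" "path_matrix p k \<noteq> 0"
      using that(2) * by presburger+
    moreover from this have "p = k + 1 \<or> k = p + 1"
      using that(1) unfolding path_matrix_def by presburger
    ultimately show False using * by blast
  qed
  have nbr: "k \<le> n - 2 \<and> (p = k + 1 \<or> k = p + 1 \<or> k = n - 2 \<and> p = n) \<or> n - 2 < k \<and> p = n - 2"
    if "p \<noteq> k" "p \<le> n" "cartan_matrix X n p k \<noteq> 0" for p
    using fork[OF that(1,3)] that(1,2) range(6) n unfolding doubleton_eq_iff by arith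
  have kn: "k = n - 2" "u = n \<and> v \<noteq> n \<or> v = n \<and> u \<noteq> n"
  proof -
    have "k \<le> n - 2" using nbr[OF range(7,2) C(1)] nbr[OF range(8,4) C(2)] neq by linarith
    moreover have "\<not> (u < k \<and> k < v \<or> v < k \<and> k < u)" using sides calculation by blast
    ultimately show "k = n - 2" "u = n \<and> v \<noteq> n \<or> v = n \<and> u \<noteq> n"
      using nbr[OF range(7,2) C(1)] nbr[OF range(8,4) C(2)] neq range n by linarith+
  qed
  \<comment> \<open>Node \<open>n\<close> is joined only to the fork, so deleting the fork isolates
    it.\<close>
  have orth: "a p \<bullet> a q = 0" if "p \<in> {1..n} - {k}" "q \<in> {1..n} - {k}" "p = n" "\<not> q = n" for p q
  proof -
    have "cartan_matrix X n n q = 0"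
      using that kn(1) n by (auto simp: D path_matrix_def doubleton_eq_iff)
    then show ?thesis using inner_base_eq_0_iff[of n q] that by simp
  qed
  from kn(2) show False
  proof (elim disjE conjE)
    assume "u = n" "v \<noteq> n"
    then show False
      by (rule cut_contradiction[OF irr k u(1) v(1) u(2) v(2), of "\<lambda>p. p = n", OF _ _ orth])
  next
    assume "v = n" "u \<noteq> n"
    then show False
      by (rule cut_contradiction[OF irr k v(1) u(1) v(2) u(2), of "\<lambda>p. p = n", OF _ _ orth])
  qed
qed

section \<open>The coefficient bound at a leaf\<close>

lemma eq_if_double_eq_L_mult:
  assumes "2 * x = L * s" "x = L * q"
  shows "s = 2 * q"
proof -
  have "L * s = L * (2 * q)" using assms by (simp only: mult.left_commute)
  then show ?thesis using L_pos by simp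
qed

text \<open>Two mechanisms give the bound. If the far end \<open>n\<close> survives in
  \<open>S\<close>, connectedness puts \<open>k\<close> at the start of what remains, so
  \<open>c k\<close> is itself an increment with square at most 2. Otherwise the squares are summed
  along a telescoping chain from 0 up to \<open>c k\<close> and, where necessary, back. The
  hypothesis \<open>lengths\<close> guarantees the first situation in types B and C for
  \<open>k < n\<close>.\<close>

lemma coefficient_le_1:
  assumes c: "c 0 = 0" "\<And>i. c i \<in> \<int>"
    and k: "k \<in> {1..n}"
    and irr: "irreducible_rs (S - {a k})" "S \<subseteq> a ` {1..n}"
    and lengths: "\<And>i. i \<in> {1..n} \<Longrightarrow> a i \<bullet> a i \<noteq> a k \<bullet> a k \<Longrightarrow> a i \<in> S"
    and support: "\<And>i. i \<in> {1..n} \<Longrightarrow> a i \<notin> S \<Longrightarrow> c i = 0"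
    and \<beta>: "\<beta> = (\<Sum>i=1..n. c i *\<^sub>R a i)" "\<beta> \<bullet> \<beta> = a k \<bullet> a k"
    and dual: "\<And>i. i \<in> {1..n} \<Longrightarrow> c i * (a i \<bullet> a i) / (\<beta> \<bullet> \<beta>) \<in> \<int>"
  shows "c k \<le> 1"
proof -
  have ints: "c i - c j \<in> \<int>" "c i + c j - c l \<in> \<int>" for i j l using c(2) by auto
  have end_bound: "c k \<le> 1"
    if "c (k - 1) = 0" "k \<le> m" "(\<Sum>i=1..m. (c i - c (i - 1))\<^sup>2) \<le> 2" for m
  proof -
    have "(c k - c (k - 1))\<^sup>2 \<le> 2"
      using increment_power2_le_sum[of k m c] that k by simp
    then show ?thesis using Ints_le_1_if_power2_le_2[OF c(2)] that(1) by simp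
  qed
  \<comment> \<open>With \<open>n\<close> in \<open>S\<close>, a node \<open>k - 1\<close> in
    \<open>S\<close> would lie on the other side of \<open>k\<close>. For \<open>k = 1\<close> the
    convention \<open>c 0 = 0\<close> takes over.\<close>
  have pred_0: "c (k - 1) = 0" if "k < n" "a n \<in> S" "X = type_D \<Longrightarrow> k \<le> n - 2"
  proof (cases "k = 1")
    case False
    then have "1 \<le> k - 1" "k - 1 < k" using k by auto
    then have "a (k - 1) \<notin> S"
      using not_both_sides[OF irr, of "k - 1" n] that by blast
    then show ?thesis using support[of "k - 1"] \<open>1 \<le> k - 1\<close> k by auto
  qed (simp add: c)
  show ?thesis
  proof (cases X)
    case type_A
    then have "a k \<bullet> a k = L" using base_lengths[OF k] by simp
    then have "(\<Sum>i=1..n. (c i - c (i - 1))\<^sup>2) + (c n)\<^sup>2 = 2"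
      using norm_path[of c n] type_A \<beta> c(1) L_pos by simp
    \<comment> \<open>Since \<open>c n\<close> is at most its square, this gives 2 c_k \<le>
      2.\<close>
    moreover have "2 * c k - c n \<le> (\<Sum>i=1..n. (c i - c (i - 1))\<^sup>2)"
      using double_le_sum_increments_power2[of c k n, OF c] k by simp
    ultimately show ?thesis using Ints_le_power2(1)[OF c(2), of n] by linarith
  next
    case type_B
    have norm: "2 * (a k \<bullet> a k) = L * (\<Sum>i=1..n. (c i - c (i - 1))\<^sup>2)"
      using norm_B[of c] type_B \<beta> c(1) by simp
    show ?thesis
    proof (cases "k = n")
      case True
      then have "(\<Sum>i=1..n. (c i - c (i - 1))\<^sup>2) = 1"
        using eq_if_double_eq_L_mult[OF norm, of "1 / 2"] base_lengths[OF k] type_B True by simp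
      then show ?thesis using le_sum_increments_power2[of c n, OF c] True by simp
    next
      case False
      then have "(\<Sum>i=1..n. (c i - c (i - 1))\<^sup>2) = 2"
        using eq_if_double_eq_L_mult[OF norm, of 1] base_lengths[OF k] by simp
      moreover have "a n \<in> S"
        by (rule lengths) (use False k type_B L_pos base_lengths[of n] base_lengths[OF k] in auto)
      ultimately show ?thesis using end_bound[of n] pred_0 False k type_B by simp
    qed
  next
    case type_C
    have norm: "2 * (a k \<bullet> a k) = L * ((\<Sum>i=1..n-1. (c i - c (i - 1))\<^sup>2) + (c (n - 1) - 2 * c n)\<^sup>2)"
      using norm_C[of c] type_C \<beta> c(1) by simp
    show ?thesis
    proof (cases "k = n")
      case True
      \<comment> \<open>Integrality of the coefficients of the coroot makes the coefficients at short roots even.\<close>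
      define d where "d i = (if i < n then c i / 2 else 0)" for i
      have "d i \<in> \<int>" for i
      proof (cases "1 \<le> i \<and> i < n")
        case True
        then show ?thesis
          using dual[of i] \<beta>(2) base_lengths[of i] base_lengths[OF k] \<open>k = n\<close> type_C L_pos
          by (simp add: d_def field_simps)
      qed (auto simp: d_def c(1) not_le)
      moreover have "d 0 = 0" by (simp add: d_def c(1))
      ultimately have d: "d (n - 1) \<le> (\<Sum>i=1..n-1. (d i - d (i - 1))\<^sup>2)" "- (d (n - 1) - c n) \<le> (d (n - 1) - c n)\<^sup>2"
        using le_sum_increments_power2[of d "n - 1"] Ints_le_power2(2)[of "d (n - 1) - c n"] c(2) by auto
      have "(\<Sum>i=1..n-1. (c i - c (i - 1))\<^sup>2) = (\<Sum>i=1..n-1. 4 * (d i - d (i - 1))\<^sup>2)"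
        by (rule sum.cong) (auto simp: d_def power2_eq_square algebra_simps)
      moreover have "(c (n - 1) - 2 * c n)\<^sup>2 = 4 * (d (n - 1) - c n)\<^sup>2"
        using rank_pos by (simp add: d_def power2_eq_square algebra_simps)
      moreover have "(\<Sum>i=1..n-1. (c i - c (i - 1))\<^sup>2) + (c (n - 1) - 2 * c n)\<^sup>2 = 4"
        using eq_if_double_eq_L_mult[OF norm, of 2] base_lengths[OF k] type_C True by simp
      \<comment> \<open>After halving, integers whose squares sum to 1 telescope to
        \<open>c n\<close>. The same argument with the original increments, whose squares sum to 4,
        would only give \<open>c n \<le> 2\<close>.\<close>
      ultimately have "(\<Sum>i=1..n-1. (d i - d (i - 1))\<^sup>2) + (d (n - 1) - c n)\<^sup>2 = 1"
        by (simp add: sum_distrib_left[symmetric])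
      then show ?thesis unfolding True using d by linarith
    next
      case False
      then have "(\<Sum>i=1..n-1. (c i - c (i - 1))\<^sup>2) + (c (n - 1) - 2 * c n)\<^sup>2 = 2"
        using eq_if_double_eq_L_mult[OF norm, of 1] base_lengths[OF k] by simp
      moreover have "0 \<le> (c (n - 1) - 2 * c n)\<^sup>2" by simp
      ultimately have "(\<Sum>i=1..n-1. (c i - c (i - 1))\<^sup>2) \<le> 2" by linarith
      moreover have "a n \<in> S"
        by (rule lengths) (use False k type_C L_pos base_lengths[of n] base_lengths[OF k] in auto)
      moreover have "k < n" "k \<le> n - 1" using False k by auto
      ultimately show ?thesis using end_bound[of "n - 1"] pred_0 type_C by simp
    qed
  next
    case type_D
    let ?s = "\<Sum>i=1..n-2. (c i - c (i - 1))\<^sup>2"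
    have "a k \<bullet> a k = L" using type_D base_lengths[OF k] by simp
    then have norm: "?s + (c (n - 1) + c n - c (n - 2))\<^sup>2 + (c n - c (n - 1))\<^sup>2 = 2"
      using norm_D[of c] type_D \<beta> c(1) L_pos by simp
    have e: "c (n - 1) + c n - c (n - 2) \<le> (c (n - 1) + c n - c (n - 2))\<^sup>2"
      "c n - c (n - 1) \<le> (c n - c (n - 1))\<^sup>2" "- (c n - c (n - 1)) \<le> (c n - c (n - 1))\<^sup>2"
      "c (n - 2) \<le> ?s"
      by (rule Ints_le_power2(1)[OF ints(2)], rule Ints_le_power2(1)[OF ints(1)],
          rule Ints_le_power2(2)[OF ints(1)], rule le_sum_increments_power2[of c, OF c])
    show ?thesis
    proof (cases "k \<le> n - 2")
      case False
      \<comment> \<open>For the two ends of the fork, the first coordinates sum to c_(n-2), and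
        adding the last two coordinates with the appropriate sign yields 2 c_k.\<close>
      then have "k = n - 1 \<or> k = n" using k by auto
      then show ?thesis
      proof
        assume "k = n - 1"
        show ?thesis unfolding \<open>k = n - 1\<close> using norm e by linarith
      next
        assume "k = n"
        show ?thesis unfolding \<open>k = n\<close> using norm e by linarith
      qed
    next
      case True
      show ?thesis
      proof (cases "a n \<in> S")
        case an: True
        have "?s \<le> 2"
          using norm zero_le_power2[of "c (n - 1) + c n - c (n - 2)"] zero_le_power2[of "c n - c (n - 1)"]
          by linarith
        then show ?thesis using end_bound[of "n - 2"] pred_0 an True k by auto
      next
        case False
        \<comment> \<open>Without node \<open>n\<close> the diagram is a path ending at
          \<open>n - 1\<close>, and the type A argument applies: rise to \<open>c k\<close>, then
          descend to 0.\<close>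
        then have "c n = 0" using support[of n] rank_pos by simp
        moreover have "2 * c k - c (n - 2) \<le> ?s"
          by (rule double_le_sum_increments_power2[of c, OF c True])
        moreover have "- (c (n - 1) + c n - c (n - 2)) \<le> (c (n - 1) + c n - c (n - 2))\<^sup>2"
          by (rule Ints_le_power2(2)[OF ints(2)])
        ultimately show ?thesis using norm e by linarith
      qed
    qed
  qed
qed

end

section \<open>From classical coordinates to the given simple system\<close>

text \<open>The type is witnessed by some simple system; a word carrying it to \<Delta> is an
  isometry and preserves all Cartan numbers.\<close>

lemma classical_base_exists:
  assumes "root_system \<Phi>" "classical \<Phi>" "simple_system \<Phi> \<Delta>"
  obtains X n a where "classical_base X n a" "a ` {1..n} = \<Delta>"
proof -
  obtain X n \<Delta>' b where X: "min_rank X \<le> n" and \<Delta>': "simple_system \<Phi> \<Delta>'"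
    and b: "bij_betw b {1..n} \<Delta>'"
    and cartan: "\<forall>i\<in>{1..n}. \<forall>j\<in>{1..n}. cartan_number (b i) (b j) = of_int (cartan_matrix X n i j)"
    using assms(2) unfolding classical_def has_type_def by blast
  obtain ws where ws: "\<Delta> = act ws ` \<Delta>'"
    using simple_system_conj[OF assms(1) \<Delta>' assms(3)] by blast
  let ?a = "act ws \<circ> b"
  have im: "?a ` {1..n} = \<Delta>" using b ws by (simp only: bij_betw_def image_comp[symmetric])
  have "classical_base X n ?a"
  proof
    show "cartan_number (?a i) (?a j) = of_int (cartan_matrix X n i j)"
      if "i \<in> {1..n}" "j \<in> {1..n}" for i j
      using cartan that by (simp add: cartan_number_def inner_act)
    show "?a i \<noteq> 0" if "i \<in> {1..n}" for i
    proof -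
      have "?a i \<in> \<Phi>" using that im assms(3) unfolding simple_system_def by blast
      then show ?thesis using assms(1) unfolding root_system_def by metis
    qed
    show "inj_on ?a {1..n}"
      using b by (intro comp_inj_on) (auto simp: bij_betw_def intro: inj_on_subset[OF bij_is_inj[OF bij_act]])
  qed (rule X)
  with im show thesis using that by blast
qed

context based_root_system
begin

lemma classical_leaf:
  assumes "classical \<Phi>" "S \<subseteq> \<Delta>" "\<epsilon> \<in> S" "irreducible_rs (S - {\<epsilon>})"
  shows classical_coef_le_1: "\<beta> \<in> pos \<Longrightarrow> norm \<beta> = norm \<epsilon> \<Longrightarrow> (\<And>\<gamma>. \<gamma> \<notin> S \<Longrightarrow> coef \<beta> \<gamma> = 0) \<Longrightarrow>
      {\<gamma>\<in>\<Delta>. norm \<gamma> \<noteq> norm \<epsilon>} \<subseteq> S \<Longrightarrow> coef \<beta> \<epsilon> \<le> 1"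
    and classical_unique_neighbour: "u \<in> S - {\<epsilon>} \<Longrightarrow> v \<in> S - {\<epsilon>} \<Longrightarrow> u \<bullet> \<epsilon> \<noteq> 0 \<Longrightarrow> v \<bullet> \<epsilon> \<noteq> 0 \<Longrightarrow> u = v"
proof -
  obtain X n a where "classical_base X n a" and a: "a ` {1..n} = \<Delta>"
    using classical_base_exists[OF root_system assms(1) simple_system] .
  then interpret classical_base X n a by simp
  obtain k where k: "k \<in> {1..n}" "\<epsilon> = a k" using assms(2,3) a by blast
  have irr: "irreducible_rs (S - {a k})" "S \<subseteq> a ` {1..n}" using assms k a by auto
  show "coef \<beta> \<epsilon> \<le> 1"
    if \<beta>: "\<beta> \<in> pos" "norm \<beta> = norm \<epsilon>" "\<And>\<gamma>. \<gamma> \<notin> S \<Longrightarrow> coef \<beta> \<gamma> = 0" "{\<gamma>\<in>\<Delta>. norm \<gamma> \<noteq> norm \<epsilon>} \<subseteq> S"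
  proof -
    \<comment> \<open>The index 0 receives the value 0 on which the increment estimates
      rely.\<close>
    define c where "c i = (if i \<in> {1..n} then coef \<beta> (a i) else 0)" for i
    have "c k \<le> 1"
    proof (rule coefficient_le_1[OF _ _ k(1) irr])
      show "a i \<in> S" if "i \<in> {1..n}" "a i \<bullet> a i \<noteq> a k \<bullet> a k" for i
        using \<beta>(4) that k a by (auto simp: norm_eq)
      show "\<beta> = (\<Sum>i=1..n. c i *\<^sub>R a i)"
      proof -
        have "\<beta> = (\<Sum>\<gamma>\<in>a ` {1..n}. coef \<beta> \<gamma> *\<^sub>R \<gamma>)"
          using span_expansion[OF root_span[OF pos_root[OF \<beta>(1)]]] a by simp
        also have "\<dots> = (\<Sum>i=1..n. c i *\<^sub>R a i)"
          by (subst sum.reindex[OF inj]) (auto simp: c_def intro!: sum.cong)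
        finally show ?thesis .
      qed
      show "\<beta> \<bullet> \<beta> = a k \<bullet> a k" using \<beta>(2) k by (simp add: norm_eq)
      show "c i * (a i \<bullet> a i) / (\<beta> \<bullet> \<beta>) \<in> \<int>" if "i \<in> {1..n}" for i
        using coef_integral(2)[OF \<beta>(1), of "a i"] that by (simp add: c_def)
    qed (auto simp: c_def \<beta>(3) coef_integral(1)[OF \<beta>(1)])
    then show ?thesis using k by (simp add: c_def)
  qed
  show "u = v" if uv: "u \<in> S - {\<epsilon>}" "v \<in> S - {\<epsilon>}" "u \<bullet> \<epsilon> \<noteq> 0" "v \<bullet> \<epsilon> \<noteq> 0"
  proof -
    obtain p q where "p \<in> {1..n}" "u = a p" "q \<in> {1..n}" "v = a q"
      using uv(1,2) irr(2) by blast
    then show ?thesis using unique_neighbour[OF irr k(1), of p q] uv k(2) by auto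
  qed
qed

text \<open>Words avoiding \<epsilon> keep its coefficient equal to 1; conversely a nonzero
  coefficient of a positive root is a positive integer, hence 1 by the bound. Describing the orbit
  by a nonvanishing coefficient is what makes the orbits of different leaves visibly
  disjoint.\<close>

lemma orbit_eq_coef_nonzero:
  assumes "classical \<Phi>" "S \<subseteq> \<Delta>" "\<epsilon> \<in> S" "irreducible_rs (S - {\<epsilon>})" "{\<gamma>\<in>\<Delta>. norm \<gamma> \<noteq> norm \<epsilon>} \<subseteq> S"
  shows "(\<lambda>w. w \<epsilon>) ` reflection_group (S - {\<epsilon>}) =
    {\<beta>\<in>pos. norm \<beta> = norm \<epsilon> \<and> (\<forall>\<gamma>. \<gamma> \<notin> S \<longrightarrow> coef \<beta> \<gamma> = 0) \<and> coef \<beta> \<epsilon> \<noteq> 0}" (is "?O = ?R")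
proof (intro equalityI subsetI)
  fix \<beta> assume "\<beta> \<in> ?O"
  then obtain ws where ws: "set ws \<subseteq> S - {\<epsilon>}" "\<beta> = act ws \<epsilon>"
    by (auto simp: reflection_group_eq_words in_lists_conv_set)
  have \<epsilon>: "\<epsilon> \<in> \<Delta>" "\<epsilon> \<in> span \<Delta>" "set ws \<subseteq> \<Delta>" using assms(2,3) ws by (auto intro: span_base)
  have c: "coef \<beta> \<gamma> = (if \<gamma> = \<epsilon> then 1 else 0)" if "\<gamma> \<notin> set ws" for \<gamma>
    using coef_act[OF \<epsilon>(3,2) that] \<epsilon>(1) ws(2) by (simp add: coef_simple)
  have "coef \<beta> \<epsilon> = 1" using c[of \<epsilon>] ws by auto
  moreover have "\<beta> \<in> \<Phi>" unfolding ws(2) by (intro act_root simple_root \<epsilon>)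
  ultimately have "\<beta> \<in> pos" using pos_if_coef_pos[of \<beta> \<epsilon>] by simp
  moreover have "coef \<beta> \<gamma> = 0" if "\<gamma> \<notin> S" for \<gamma>
  proof -
    have "\<gamma> \<notin> set ws" "\<gamma> \<noteq> \<epsilon>" using that ws(1) assms(3) by auto
    then show ?thesis by (simp add: c)
  qed
  ultimately show "\<beta> \<in> ?R" using \<open>coef \<beta> \<epsilon> = 1\<close> ws(2) by (simp add: norm_act)
next
  fix \<beta> assume \<beta>: "\<beta> \<in> ?R"
  then have "coef \<beta> \<epsilon> \<le> 1" using classical_coef_le_1[OF assms(1-4)] assms(5) by simp
  moreover have "0 < coef \<beta> \<epsilon>" using \<beta> by (auto simp: pos_iff order_less_le)
  moreover have "coef \<beta> \<epsilon> \<in> \<int>" using \<beta> coef_integral(1) by simp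
  ultimately have "coef \<beta> \<epsilon> = 1" by (auto elim!: Ints_cases)
  then obtain ws where "ws \<in> lists (S - {\<epsilon>})" "\<beta> = act ws \<epsilon>"
    using coef_1_conj[OF _ assms(2,3), of \<beta>] \<beta> by auto
  then show "\<beta> \<in> ?O" by (auto simp: reflection_group_eq_words)
qed

text \<open>Connectedness of \<open>S\<close> gives the leaf a neighbour, connectedness of
  \<open>S - {\<epsilon>}\<close> makes it unique. The definite description in
  \<open>leaf_neighbour\<close> is thereby justified, and deleting the leaf and its neighbour leaves
  exactly the simple roots of \<open>S\<close> orthogonal to \<epsilon>.\<close>

lemma leaf_summand:
  assumes "classical \<Phi>" "S \<subseteq> \<Delta>" "\<epsilon> \<in> S" "irreducible_rs S" "irreducible_rs (S - {\<epsilon>})"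
    and "{\<gamma>\<in>\<Delta>. norm \<gamma> \<noteq> norm \<epsilon>} \<subseteq> S"
  shows "real (card {\<beta>\<in>pos. norm \<beta> = norm \<epsilon> \<and> (\<forall>\<gamma>. \<gamma> \<notin> S \<longrightarrow> coef \<beta> \<gamma> = 0) \<and> coef \<beta> \<epsilon> \<noteq> 0}) =
    real (card (reflection_group (S - {\<epsilon>}))) /
    real (card (if S = {\<epsilon>} then reflection_group {} else reflection_group (S - {\<epsilon>, leaf_neighbour S \<epsilon>})))"
proof -
  let ?K = "{\<gamma>\<in>S - {\<epsilon>}. \<gamma> \<bullet> \<epsilon> = 0}"
  have \<epsilon>: "\<epsilon> \<in> \<Delta>" "\<epsilon> \<bullet> \<epsilon> \<noteq> 0" using assms(2,3) simple_nonzero by auto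
  have obtuse: "\<epsilon> \<bullet> \<gamma> \<le> 0" if "\<gamma> \<in> S - {\<epsilon>}" for \<gamma>
    using simple_obtuse[OF \<epsilon>(1)] that assms(2) by auto
  have J: "S - {\<epsilon>} \<subseteq> \<Delta>" "?K \<subseteq> \<Delta>" using assms(2) by auto
  have "(if S = {\<epsilon>} then reflection_group {} else reflection_group (S - {\<epsilon>, leaf_neighbour S \<epsilon>})) = reflection_group ?K"
  proof (cases "S = {\<epsilon>}")
    case True
    then have K: "?K = {}" by auto
    show ?thesis unfolding if_P[OF True] K ..
  next
    case False
    then obtain \<eta> where "\<eta> \<in> S" "\<eta> \<noteq> \<epsilon>" using assms(3) by blast
    then obtain \<beta> where \<beta>: "\<beta> \<in> S - {\<epsilon>}" "\<beta> \<bullet> \<epsilon> \<noteq> 0"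
      using irreducible_cut[OF assms(4,3), of \<eta> "\<lambda>x. x = \<epsilon>"] by (auto simp: inner_commute)
    have eq: "{\<gamma>\<in>S. \<gamma> \<bullet> \<epsilon> \<noteq> 0} = {\<epsilon>, \<beta>}"
      using \<beta> \<epsilon>(2) assms(3) classical_unique_neighbour[OF assms(1,2,3,5) _ \<beta>(1) _ \<beta>(2)] by blast
    have "leaf_neighbour S \<epsilon> = \<beta>"
      unfolding leaf_neighbour_def eq by (rule the_equality) (use \<beta> in auto)
    moreover have "S - {\<epsilon>, \<beta>} = ?K" using eq by blast
    ultimately show ?thesis using False by simp
  qed
  \<comment> \<open>A finite nonempty group has nonzero cardinality, so the orbit equation may be
    divided by it.\<close>
  moreover have "act [] \<in> reflection_group ?K" unfolding reflection_group_eq_words by blast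
  then have "card (reflection_group ?K) \<noteq> 0"
    using finite_reflection_group[OF J(2)] by auto
  moreover have "card (reflection_group (S - {\<epsilon>})) =
      card ((\<lambda>w. w \<epsilon>) ` reflection_group (S - {\<epsilon>})) * card (reflection_group ?K)"
    by (rule orbit_stabilizer[OF J(1) obtuse])
  ultimately show ?thesis
    unfolding orbit_eq_coef_nonzero[OF assms(1,2,3,5,6), symmetric] by simp
qed

end

theorem corollary8p4:
  fixes \<Phi> \<Delta> :: "'a::euclidean_space set" and t :: real and r :: nat and \<epsilon> :: "nat \<Rightarrow> 'a"
  assumes "root_system \<Phi>" and "irreducible_rs \<Phi>" and "classical \<Phi>"
    and "simple_system \<Phi> \<Delta>"
    and "t \<in> norm ` \<Phi>"
    and "bij_betw \<epsilon> {1..r} {\<alpha>\<in>\<Delta>. norm \<alpha> = t}"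
    and "\<And>i. i \<in> {1..r} \<Longrightarrow> irreducible_rs (generated_subsystem \<Phi> (\<Delta> - \<epsilon> ` {1..i}))"
  shows "real (card {\<alpha>\<in>positive_roots \<Phi> \<Delta>. norm \<alpha> = t}) =
    (\<Sum>i=1..r. real (card (W_leaf \<Delta> \<epsilon> i)) / real (card (W_leaf_neighbour \<Delta> \<epsilon> i)))"
proof -
  interpret based_root_system \<Phi> \<Delta> by unfold_locales (rule assms(1), rule assms(4))
  define S where "S i = \<Delta> - \<epsilon> ` {1..<i}" for i
  define R where "R i = {\<beta>\<in>pos. norm \<beta> = t \<and> (\<forall>\<gamma>. \<gamma> \<notin> S i \<longrightarrow> coef \<beta> \<gamma> = 0) \<and> coef \<beta> (\<epsilon> i) \<noteq> 0}" for i
  have \<epsilon>: "\<epsilon> i \<in> \<Delta>" "norm (\<epsilon> i) = t" if "i \<in> {1..r}" for i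
    using assms(6) that by (auto simp: bij_betw_def)
  have \<epsilon>_inj: "\<epsilon> i = \<epsilon> j \<longleftrightarrow> i = j" if "i \<in> {1..r}" "j \<in> {1..r}" for i j
    using inj_on_eq_iff[OF bij_betw_imp_inj_on[OF assms(6)]] that by blast
  have S_Suc: "S i - {\<epsilon> i} = \<Delta> - \<epsilon> ` {1..i}" if "i \<in> {1..r}" for i
  proof -
    have "{1..i} = insert i {1..<i}" using that by auto
    then show ?thesis unfolding S_def by auto
  qed
  \<comment> \<open>The case \<open>i = 0\<close> is outside the range of the ordering hypothesis
    and comes from irreducibility of \<Phi>.\<close>
  have irr: "irreducible_rs (\<Delta> - \<epsilon> ` {1..i})" if "i \<le> r" for i
  proof (cases "i = 0")
    case True
    then show ?thesis using irreducible_simple[OF assms(2)] by simp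
  next
    case False
    then show ?thesis
      using irreducible_generating_set[OF assms(1) _ assms(7)[of i]] simple_subset that by auto
  qed
  have summand: "real (card (W_leaf \<Delta> \<epsilon> i)) / real (card (W_leaf_neighbour \<Delta> \<epsilon> i)) = real (card (R i))"
    if i: "i \<in> {1..r}" for i
  proof -
    \<comment> \<open>\<open>S i\<close> still contains \<epsilon>_i, so its connectedness is the
      instance \<open>i - 1\<close> of \<open>irr\<close>, while the instance \<open>i\<close>
      concerns the diagram after the leaf is removed.\<close>
    have "{1..<i} = {1..i - 1}" "i - 1 \<le> r" using i by auto
    then have "irreducible_rs (S i)" using irr[of "i - 1"] by (simp only: S_def)
    moreover have "irreducible_rs (S i - {\<epsilon> i})" using S_Suc[OF i] irr[of i] i by (simp del: One_nat_def)
    moreover have "\<epsilon> i \<in> S i" unfolding S_def using i \<epsilon>(1)[OF i] \<epsilon>_inj by force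
    moreover have "{\<gamma>\<in>\<Delta>. norm \<gamma> \<noteq> norm (\<epsilon> i)} \<subseteq> S i"
      unfolding S_def using i \<epsilon> by auto
    moreover have "S i \<subseteq> \<Delta>" by (auto simp: S_def)
    ultimately show ?thesis
      using leaf_summand[OF assms(3), of "S i" "\<epsilon> i"] \<epsilon>(2)[OF i]
      by (simp add: W_leaf_def W_leaf_neighbour_def remaining_simple_def S_def R_def Let_def)
  qed
  have "{\<alpha>\<in>pos. norm \<alpha> = t} = (\<Union>i\<in>{1..r}. R i)"
  proof (intro equalityI subsetI)
    fix \<beta> assume "\<beta> \<in> {\<alpha>\<in>pos. norm \<alpha> = t}"
    then have \<beta>: "\<beta> \<in> pos" "norm \<beta> = t" by auto
    have "\<exists>i. i \<in> {1..r} \<and> coef \<beta> (\<epsilon> i) \<noteq> 0"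
    proof (rule ccontr)
      assume none: "\<not> ?thesis"
      let ?T = "{\<gamma>\<in>\<Delta>. norm \<gamma> \<noteq> t}"
      have "coef \<beta> \<gamma> = 0" if "\<gamma> \<notin> ?T" for \<gamma>
      proof (cases "\<gamma> \<in> \<Delta>")
        case True
        then have "\<gamma> \<in> \<epsilon> ` {1..r}" using that assms(6) by (auto simp: bij_betw_def)
        then show ?thesis using none by auto
      qed (rule coef_notin)
      then obtain \<alpha> ws where "\<alpha> \<in> ?T" "\<beta> = act ws \<alpha>"
        using pos_conj_simple[OF \<beta>(1), of ?T] by auto
      then show False using \<beta>(2) by (simp add: norm_act)
    qed
    then obtain i where i: "i \<in> {1..r}" "coef \<beta> (\<epsilon> i) \<noteq> 0"
      and least: "\<And>j. j < i \<Longrightarrow> \<not> (j \<in> {1..r} \<and> coef \<beta> (\<epsilon> j) \<noteq> 0)"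
      using exists_least_iff[of "\<lambda>i. i \<in> {1..r} \<and> coef \<beta> (\<epsilon> i) \<noteq> 0"] by auto
    have "coef \<beta> \<gamma> = 0" if \<gamma>: "\<gamma> \<notin> S i" for \<gamma>
    proof (cases "\<gamma> \<in> \<Delta>")
      case True
      then obtain j where "j \<in> {1..<i}" "\<gamma> = \<epsilon> j" using \<gamma> by (auto simp: S_def)
      then show ?thesis using least[of j] i by auto
    qed (rule coef_notin)
    then have "\<beta> \<in> R i" using \<beta> i(2) by (simp add: R_def)
    with i(1) show "\<beta> \<in> (\<Union>i\<in>{1..r}. R i)" by blast
  qed (auto simp: R_def)
  moreover have "card (\<Union>i\<in>{1..r}. R i) = (\<Sum>i=1..r. card (R i))"
  proof (rule card_UN_disjoint)
    show "\<forall>i\<in>{1..r}. finite (R i)"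
      by (auto simp: R_def intro!: finite_subset[OF _ finite_roots] pos_root)
    \<comment> \<open>For \<open>i < j\<close> the root \<epsilon>_i has already been deleted from
      \<open>S j\<close>: its coefficient vanishes on \<open>R j\<close> but not on
      \<open>R i\<close>.\<close>
    have "R i \<inter> R j = {}" if "i \<in> {1..r}" "i < j" for i j
    proof -
      have "\<epsilon> i \<notin> S j" unfolding S_def using that by auto
      then show ?thesis by (auto simp: R_def)
    qed
    then show "\<forall>i\<in>{1..r}. \<forall>j\<in>{1..r}. i \<noteq> j \<longrightarrow> R i \<inter> R j = {}"
      by (metis Int_commute linorder_neqE_nat)
  qed simp
  ultimately show ?thesis using summand by simp
qed

end
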